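(* Let $t$ be a positive integer and $g=2t+2$. Let $\omega\in\mathcal{DD}_{(2t+2)}$, let $\mathbf{v}=(v_1,\dots,v_t)\in\mathbb{Z}^t$ be its $V_{g,t}$-coding, and set $r_i=v_i-t-1$ for $1\leq i\leq t$. Then $$\lvert\omega\rvert=\frac{1}{g}\sum_{i=1}^{t}r_i^2-\frac{(g/2-1)(g-1)}{12}.$$ Moreover, setting $\alpha_i(\omega)=\#\{u\in\omega: h_u=g-i,\ \varepsilon_u=1\}$ for $1\leq i\leq g-1$, for every field $F$ and every function $\tau:\mathbb{Z}\to F^{\times}$, $$\prod_{s\in\omega}\frac{\tau(h_s-\varepsilon_s g)}{\tau(h_s)}=\prod_{i=1}^{g-1}\left(\frac{\tau(-i)}{\tau(i)}\right)^{\alpha_i(\omega)}\prod_{i=1}^{t}\frac{\tau(r_i)}{\tau(i)}\prod_{1\leq i<j\leq t}\frac{\tau(r_i-r_j)}{\tau(j-i)}\,\frac{\tau(r_i+r_j)}{\tau(g-i-j)}.$$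
   Context: A partition $\lambda=(\lambda_1\geq\lambda_2\geq\dots)$ (with $\lambda_i=0$ for $i>\ell(\lambda)$) has Ferrers diagram consisting of boxes $(i,j)$ with $1\leq j\leq\lambda_i$; products/counts "over $s\in\omega$" range over these boxes. $\lambda'$ is the conjugate partition, $|\lambda|=\sum\lambda_i$. The hook length of a box $s=(i,j)$ is $h_s=\lambda_i-j+\lambda'_j-i+1$. The Durfee size is $d_\lambda=\max\{s:\lambda_s\geq s\}$. For a box $s=(i,j)$, $\varepsilon_s=-1$ if $i>j$ and $\varepsilon_s=1$ otherwise. A partition is a $k$-core if none of its hook lengths is divisible by $k$. $\mathcal{DD}$ is the set of partitions $\lambda$ with $\lambda_i=\lambda'_i+1$ for all $1\leq i\leq d_\lambda$; $\mathcal{DD}_{(k)}$ is the set of its elements that are $k$-cores. $V_{g,t}$-coding: for a partition $\lambda$ and each residue $r\in\{0,\dots,g-1\}$, let $\beta_r=g+\max\{\lambda_j-j: j\geq 1,\ \lambda_j-j\equiv r \pmod g\}$ ($j$ ranging over all positive integers, $\lambda_j=0$ for $j>\ell(\lambda)$). These are distinct; list them decreasingly $\beta_{\sigma(1)}>\dots>\beta_{\sigma(g)}$. The $V_{g,t}$-coding of $\lambda$ is $(v_1,\dots,v_t)=(\beta_{\sigma(1)},\dots,\beta_{\sigma(t)})$. *)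

theory Defs
  imports Complex_Main
begin

definition is_partition :: "nat list \<Rightarrow> bool" where
  "is_partition lam \<longleftrightarrow> sorted_wrt (\<ge>) lam \<and> 0 \<notin> set lam"

definition part :: "nat list \<Rightarrow> nat \<Rightarrow> nat" where
  "part lam i = (if 1 \<le> i \<and> i \<le> length lam then lam ! (i - 1) else 0)"

definition conj_part :: "nat list \<Rightarrow> nat \<Rightarrow> nat" where
  "conj_part lam j = card {i. 1 \<le> i \<and> i \<le> length lam \<and> j \<le> part lam i}"

definition psize :: "nat list \<Rightarrow> nat" where
  "psize lam = sum_list lam"

definition boxes :: "nat list \<Rightarrow> (nat \<times> nat) set" where
  "boxes lam = {(i, j). 1 \<le> i \<and> 1 \<le> j \<and> j \<le> part lam i}"

definition hook :: "nat list \<Rightarrow> nat \<times> nat \<Rightarrow> int" where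
  "hook lam s = (case s of (i, j) \<Rightarrow>
      int (part lam i) - int j + int (conj_part lam j) - int i + 1)"

definition durfee :: "nat list \<Rightarrow> nat" where
  "durfee lam = Max {s. s \<le> part lam s}"

definition eps :: "nat \<times> nat \<Rightarrow> int" where
  "eps s = (case s of (i, j) \<Rightarrow> if i > j then -1 else 1)"

definition is_core :: "nat \<Rightarrow> nat list \<Rightarrow> bool" where
  "is_core k lam \<longleftrightarrow> (\<forall>s\<in>boxes lam. \<not> (int k dvd hook lam s))"

definition DD :: "nat list \<Rightarrow> bool" where
  "DD lam \<longleftrightarrow> is_partition lam \<and>
     (\<forall>i. 1 \<le> i \<and> i \<le> durfee lam \<longrightarrow> part lam i = conj_part lam i + 1)"

definition DD_core :: "nat \<Rightarrow> nat list \<Rightarrow> bool" where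
  "DD_core k lam \<longleftrightarrow> DD lam \<and> is_core k lam"

definition beta :: "nat list \<Rightarrow> nat \<Rightarrow> nat \<Rightarrow> int" where
  "beta lam g r = int g + (GREATEST x. x \<in> {int (part lam j) - int j | j. 1 \<le> j \<and>
                                   (int (part lam j) - int j) mod int g = int r})"

definition vcoding :: "nat list \<Rightarrow> nat \<Rightarrow> nat \<Rightarrow> int list" where
  "vcoding lam g t = take t (rev (sorted_list_of_set (beta lam g ` {0..<g})))"

end

theory Submission
  imports "HOL-Library.Multiset" Defs  (* Defs last: Multiset also has a constant named part *)
begin

text \<open>
  Encode a partition by the set \<open>S\<close> of the integers \<open>\<lambda>\<^sub>i - i\<close>. Boxes correspond to the pairs
  \<open>x \<in> S\<close>, \<open>y \<notin> S\<close>, \<open>y < x\<close>, with hook length \<open>x - y\<close>. For a doubled distinct partition \<open>0 \<notin> S\<close>,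
  and \<open>x \<in> S\<close> iff \<open>- x \<notin> S\<close> for \<open>x \<noteq> 0\<close>; moreover \<open>\<epsilon> = 1\<close> iff \<open>x + y \<ge> 0\<close>. A \<open>g\<close>-core satisfies
  \<open>S - g \<subseteq> S\<close>, the numbers \<open>\<beta>\<^sub>r\<close> form the set \<open>B = (S + g) - S\<close>, and
  \<open>B - g/2 = {\<plusminus>r\<^sub>i} \<union> {0, - g/2}\<close>.

  Put \<open>c(n) = #{x \<in> S. x - n \<notin> S}\<close>. Because \<open>S - g \<subseteq> S\<close>, the second difference
  \<open>c(n - g) - 2 c(n) + c(n + g)\<close> counts the pairs in \<open>B\<close> with difference \<open>n\<close>. Reflection
  \<open>(x, y) \<mapsto> (- y, - x)\<close> determines how many of the \<open>c(n)\<close> boxes of hook length \<open>n\<close> have \<open>\<epsilon> = 1\<close>.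
  Together these give the multiset identity
  \<open>{\<bar>h - \<epsilon> g\<bar>} + R\<^sub>0 = {h} + R\<close>, where \<open>R\<close> consists of the \<open>r\<^sub>i\<close>, \<open>r\<^sub>i - r\<^sub>j\<close>, \<open>r\<^sub>i + r\<^sub>j\<close> with \<open>i < j\<close>
  and \<open>R\<^sub>0\<close> is \<open>R\<close> for the empty partition. Multiplying \<open>\<tau>\<close> over it gives the product
  formula, and summing squares over it gives the size formula.
\<close>

section \<open>Differences and sums of a set of positive integers\<close>

definition ordered_pairs :: "int set \<Rightarrow> (int \<times> int) set" where
  "ordered_pairs P = {(p, q). p \<in> P \<and> q \<in> P \<and> q < p}"

text \<open>The values of the positive roots of type \<open>B\<close> at a vector whose coordinates
  are the elements of \<open>P\<close>, with multiplicity.\<close>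

definition root_values :: "int set \<Rightarrow> int multiset" where
  "root_values P = mset_set P + image_mset (\<lambda>(p, q). p - q) (mset_set (ordered_pairs P))
     + image_mset (\<lambda>(p, q). p + q) (mset_set (ordered_pairs P))"

lemma finite_ordered_pairs: "finite P \<Longrightarrow> finite (ordered_pairs P)"
  by (rule finite_subset[of _ "P \<times> P"]) (auto simp: ordered_pairs_def)

lemma count_image_mset_set:
  assumes "finite A"
  shows "count (image_mset f (mset_set A)) n = card {a \<in> A. f a = n}"
proof -
  have "f -` {n} \<inter> A = {a \<in> A. f a = n}" by auto
  then show ?thesis using assms by (simp add: count_image_mset)
qed

lemma count_root_values:
  assumes "finite P"
  shows "count (root_values P) n = of_bool (n \<in> P) + card {p \<in> P. p - n \<in> P \<and> n > 0}
     + card {p \<in> P. n - p \<in> P \<and> n - p < p}"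
proof -
  have "bij_betw fst {a \<in> ordered_pairs P. (\<lambda>(p, q). p - q) a = n} {p \<in> P. p - n \<in> P \<and> n > 0}"
    by (rule bij_betw_byWitness[where f' = "\<lambda>p. (p, p - n)"]) (auto simp: ordered_pairs_def)
  moreover have "bij_betw fst {a \<in> ordered_pairs P. (\<lambda>(p, q). p + q) a = n}
      {p \<in> P. n - p \<in> P \<and> n - p < p}"
    by (rule bij_betw_byWitness[where f' = "\<lambda>p. (p, n - p)"]) (auto simp: ordered_pairs_def)
  ultimately show ?thesis
    using assms finite_ordered_pairs[OF assms]
    by (simp add: root_values_def count_image_mset_set bij_betw_same_card)
qed

lemma card_filter_of_bool: "finite A \<Longrightarrow> card {a \<in> A. R a} = (\<Sum>a\<in>A. of_bool (R a))"
  by (simp add: Int_def)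

lemma card_filter_singleton: "finite A \<Longrightarrow> card {a \<in> A. a = x} = of_bool (x \<in> A)"
proof -
  have "{a \<in> A. a = x} = (if x \<in> A then {x} else {})" by auto
  then show ?thesis by simp
qed

text \<open>Solutions come in pairs: \<open>p\<close> arises from \<open>(0, p)\<close> and
  \<open>(- p, 0)\<close>, \<open>p - q\<close> from \<open>(q, p)\<close> and
  \<open>(- p, - q)\<close>, \<open>p + q\<close> from \<open>(- q, p)\<close> and
  \<open>(- p, q)\<close>. Unpaired are only the differences \<open>2 * p\<close> between
  \<open>- p\<close> and \<open>p\<close> and those that involve \<open>- h\<close>.\<close>

lemma card_differences_signed_set:
  fixes P :: "int set"
  assumes fin: "finite P" and pos: "\<And>p. p \<in> P \<Longrightarrow> 0 < p" and h: "0 < h" "h \<notin> P" and n: "0 < n"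
    and Q: "Q = P \<union> uminus ` P \<union> {0, - h}"
  shows "card {b \<in> Q. b + n \<in> Q} = 2 * count (root_values P) n
     + of_bool (even n \<and> n div 2 \<in> Q) + of_bool (n + h \<in> Q) + of_bool (n - h \<in> Q)"
proof -
  have mem: "x \<in> Q \<longleftrightarrow> x \<in> P \<or> - x \<in> P \<or> x = 0 \<or> x = - h" for x
    unfolding Q by (auto simp: image_iff) (metis minus_minus)
  have np: "x \<le> 0 \<Longrightarrow> x \<notin> P" for x using pos[of x] by linarith
  have finQ: "finite Q" using fin by (simp add: Q)
  have "card {b \<in> Q. b + n \<in> Q} = (\<Sum>b\<in>Q. of_bool (b + n \<in> Q))"
    by (rule card_filter_of_bool[OF finQ])
  also have "\<dots> = (\<Sum>b\<in>P. of_bool (b + n \<in> Q)) + (\<Sum>b\<in>uminus ` P. of_bool (b + n \<in> Q))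
      + (\<Sum>b\<in>{0, - h}. of_bool (b + n \<in> Q))"
  proof -
    have 1: "(P \<union> uminus ` P) \<inter> {0, - h} = {}" using h pos by fastforce
    have 2: "P \<inter> uminus ` P = {}" using np by (auto dest!: pos)
    show ?thesis
      by (subst (1) Q, subst sum.union_disjoint[OF _ _ 1], use fin in simp, simp,
          subst sum.union_disjoint[OF _ _ 2], use fin in simp_all)
  qed
  also have "(\<Sum>b\<in>P. of_bool (b + n \<in> Q)) = (\<Sum>b\<in>P. of_bool (b + n \<in> P) :: nat)"
  proof (rule sum.cong[OF refl])
    fix b assume "b \<in> P"
    then have "0 < b + n" using pos n by (simp add: add_pos_pos)
    then show "of_bool (b + n \<in> Q) = (of_bool (b + n \<in> P) :: nat)"
      using h np[of "- (b + n)"] by (simp add: mem)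
  qed
  also have "\<dots> = card {p \<in> P. p + n \<in> P}" by (rule card_filter_of_bool[OF fin, symmetric])
  also have "\<dots> = card {p \<in> P. p - n \<in> P}"
    by (rule bij_betw_same_card[of "\<lambda>p. p + n"],
        rule bij_betw_byWitness[where f' = "\<lambda>p. p - n"]) auto
  also have "(\<Sum>b\<in>uminus ` P. of_bool (b + n \<in> Q)) = (\<Sum>p\<in>P. of_bool (n - p \<in> Q) :: nat)"
    by (subst sum.reindex) (auto simp: o_def algebra_simps)
  \<comment> \<open>The four terms are the ways for \<open>n - p\<close> to lie in \<open>P\<close>
    or in \<open>- P\<close>, or to be \<open>0\<close> or \<open>- h\<close>.\<close>
  also have "\<dots> = (\<Sum>p\<in>P. of_bool (n - p \<in> P) + of_bool (p - n \<in> P) + of_bool (p = n)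
      + of_bool (p = n + h))"
  proof (rule sum.cong[OF refl])
    fix p
    consider "n - p < 0" | "n - p = 0" | "0 < n - p" by linarith
    then show "of_bool (n - p \<in> Q) = (of_bool (n - p \<in> P) + of_bool (p - n \<in> P)
        + of_bool (p = n) + of_bool (p = n + h) :: nat)"
    proof cases
      case 1
      then show ?thesis using np[of "n - p"] h by (auto simp: mem of_bool_def)
    next
      case 2
      then show ?thesis using np[of "n - p"] np[of "p - n"] h by (auto simp: mem of_bool_def)
    next
      case 3
      then show ?thesis using np[of "p - n"] h by (auto simp: mem of_bool_def)
    qed
  qed
  also have "\<dots> = card {p \<in> P. n - p \<in> P} + card {p \<in> P. p - n \<in> P} + of_bool (n \<in> P)
      + of_bool (n + h \<in> P)"
    by (simp only: sum.distrib card_filter_of_bool[OF fin, symmetric] card_filter_singleton[OF fin])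
  \<comment> \<open>The involution taking \<open>p\<close> to \<open>n - p\<close> fixes only
    \<open>n div 2\<close>, for even \<open>n\<close>.\<close>
  also have "card {p \<in> P. n - p \<in> P} = 2 * card {p \<in> P. n - p \<in> P \<and> n - p < p}
      + of_bool (even n \<and> n div 2 \<in> P)"
  proof -
    have parity: "n < 2 * p" if "odd n" "\<not> 2 * p < n" for p
      using that by (metis dvd_triv_left not_less_iff_gr_or_eq)
    have e: "{p \<in> P. n - p \<in> P} = ({p \<in> P. n - p \<in> P \<and> n - p < p} \<union> {p \<in> P. n - p \<in> P \<and> p < n - p})
        \<union> {p \<in> P. even n \<and> p = n div 2}"
      by (auto intro: parity)
    have "card {p \<in> P. n - p \<in> P \<and> p < n - p} = card {p \<in> P. n - p \<in> P \<and> n - p < p}"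
      by (rule bij_betw_same_card[of "\<lambda>p. n - p"],
          rule bij_betw_byWitness[where f' = "\<lambda>p. n - p"]) auto
    moreover have "card {p \<in> P. even n \<and> p = n div 2} = of_bool (even n \<and> n div 2 \<in> P)"
      using card_filter_singleton[OF fin, of "n div 2"] by (cases "even n") auto
    ultimately show ?thesis
      unfolding e using fin by (subst card_Un_disjoint, simp, simp, force)+ simp
  qed
  also have "(\<Sum>b\<in>{0, - h}. of_bool (b + n \<in> Q)) = (of_bool (n \<in> P) + of_bool (n - h \<in> Q) :: nat)"
    using h n np[of "- n"] by (simp add: mem algebra_simps)
  finally have "card {b \<in> Q. b + n \<in> Q} = 2 * count (root_values P) n
     + of_bool (even n \<and> n div 2 \<in> P) + of_bool (n + h \<in> P) + of_bool (n - h \<in> Q)"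
    using n by (simp add: count_root_values[OF fin])
  moreover have "n + h \<in> Q \<longleftrightarrow> n + h \<in> P"
    using n h np[of "- (n + h)"] by (simp add: mem)
  moreover have "n div 2 \<in> Q \<longleftrightarrow> n div 2 \<in> P" if "even n"
  proof -
    have "0 < n div 2" using n that by (auto elim: evenE)
    then show ?thesis using h np[of "- (n div 2)"] by (auto simp: mem)
  qed
  ultimately show ?thesis by (cases "even n") simp_all
qed

section \<open>Symmetric Maya sets\<close>

text \<open>For the Maya set of a partition these pairs stand for the boxes; \<open>gap\<close> is
  then the hook length, and \<open>side\<close> is the sign \<open>eps\<close> if the partition is
  doubled distinct.\<close>

definition inversions :: "int set \<Rightarrow> (int \<times> int) set" where
  "inversions S = {(x, y). x \<in> S \<and> y \<notin> S \<and> y < x}"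

definition gap :: "int \<times> int \<Rightarrow> int" where
  "gap p = fst p - snd p"

definition side :: "int \<times> int \<Rightarrow> int" where
  "side p = (if fst p + snd p \<ge> 0 then 1 else -1)"

text \<open>
  \<open>S\<close> is the set of values \<open>\<lambda>\<^sub>i - i\<close>; for it \<open>reflect\<close> says that the partition is
  doubled distinct, and \<open>core\<close> says that it is a \<open>2 * h\<close>-core.
\<close>

locale doubled_maya =
  fixes S :: "int set" and h :: int
  assumes h_pos: "0 < h"
    and zero_notin: "0 \<notin> S"
    and reflect: "x \<noteq> 0 \<Longrightarrow> - x \<in> S \<longleftrightarrow> x \<notin> S"
    and core: "x \<in> S \<Longrightarrow> x - 2 * h \<in> S"
    and bdd: "bdd_above S"
begin

text \<open>On the abacus with \<open>2 * h\<close> runners, the lowest empty position of each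
  runner: the numbers \<open>beta\<close>.\<close>

definition first_gaps :: "int set" where
  "first_gaps = {b. b \<notin> S \<and> b - 2 * h \<in> S}"

text \<open>The numbers \<open>r i\<close>: after subtracting \<open>h\<close> the first gaps are
  nearly symmetric about \<open>0\<close>, and the positive half is kept.\<close>

definition pos_gaps :: "int set" where
  "pos_gaps = {p. 0 < p \<and> p + h \<in> first_gaps}"

text \<open>For \<open>n > 0\<close> the number of boxes with hook length \<open>n\<close>. Other
  arguments occur because second differences with step \<open>2 * h\<close> reach them.\<close>

definition movable :: "int \<Rightarrow> nat" where
  "movable n = card {x \<in> S. x - n \<notin> S}"

section \<open>Bounds and finiteness\<close>

lemma bounds:
  obtains N where "0 < N" "\<And>x. x \<in> S \<Longrightarrow> x < N" "\<And>x. x \<notin> S \<Longrightarrow> - N < x"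
proof -
  obtain M where M: "\<And>x. x \<in> S \<Longrightarrow> x \<le> M" using bdd by (auto simp: bdd_above_def)
  define N where "N = \<bar>M\<bar> + 1"
  have le: "x < N" if "x \<in> S" for x using M[OF that] by (simp add: N_def)
  have "- N < x" if "x \<notin> S" for x
  proof (cases "x = 0")
    case False
    then have "- x \<in> S" using reflect that by blast
    then show ?thesis using le[of "- x"] by linarith
  qed (simp add: N_def)
  then show thesis using that[of N] le by (simp add: N_def)
qed

lemma finite_movable: "finite {x \<in> S. x - n \<notin> S}"
proof -
  obtain N where N: "0 < N" "\<And>x. x \<in> S \<Longrightarrow> x < N" "\<And>x. x \<notin> S \<Longrightarrow> - N < x" by (rule bounds) blast
  have "n - N \<le> x \<and> x \<le> N" if "x \<in> S" "x - n \<notin> S" for x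
    using N(2)[OF that(1)] N(3)[OF that(2)] by linarith
  then have "{x \<in> S. x - n \<notin> S} \<subseteq> {n - N..N}" by auto
  then show ?thesis by (rule finite_subset) simp
qed

lemma finite_first_gaps: "finite first_gaps"
proof -
  have "first_gaps = (\<lambda>x. x + 2 * h) ` {x \<in> S. x - (- 2 * h) \<notin> S}"
    by (force simp: first_gaps_def image_iff)
  then show ?thesis using finite_movable[of "- 2 * h"] by simp
qed

lemma finite_pos_gaps: "finite pos_gaps"
proof -
  have "pos_gaps \<subseteq> (\<lambda>b. b - h) ` first_gaps" by (force simp: pos_gaps_def image_iff)
  then show ?thesis using finite_first_gaps finite_surj by blast
qed

lemma finite_positive: "finite {x \<in> S. 0 < x}"
proof -
  obtain N where "\<And>x. x \<in> S \<Longrightarrow> x < N" by (rule bounds) blast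
  then have "{x \<in> S. 0 < x} \<subseteq> {0..N}" by (auto simp: less_imp_le)
  then show ?thesis by (rule finite_subset) simp
qed

lemma finite_inversions: "finite (inversions S)"
proof -
  obtain N where N: "0 < N" "\<And>x. x \<in> S \<Longrightarrow> x < N" "\<And>x. x \<notin> S \<Longrightarrow> - N < x" by (rule bounds) blast
  have "inversions S \<subseteq> {- N..N} \<times> {- N..N}"
  proof
    fix p assume "p \<in> inversions S"
    then show "p \<in> {- N..N} \<times> {- N..N}"
      using N(2)[of "fst p"] N(3)[of "snd p"] by (auto simp: inversions_def)
  qed
  then show ?thesis by (rule finite_subset) simp
qed

section \<open>Second differences of the hook length counts\<close>

lemma movable_step: "movable n = movable (n + 2 * h) + card {b \<in> first_gaps. b + n \<in> S}"
proof -
  have "card {b \<in> first_gaps. b + n \<in> S} = card {x \<in> S. x - n \<in> first_gaps}"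
    by (rule bij_betw_same_card[of "\<lambda>b. b + n"],
        rule bij_betw_byWitness[where f' = "\<lambda>x. x - n"]) auto
  \<comment> \<open>By \<open>core\<close> a runner stays empty above an empty position, so either
    \<open>x - n - 2 * h\<close> is empty too or \<open>x - n\<close> is the first gap.\<close>
  moreover have "{x \<in> S. x - n \<notin> S} = {x \<in> S. x - (n + 2 * h) \<notin> S} \<union> {x \<in> S. x - n \<in> first_gaps}"
    unfolding first_gaps_def diff_diff_add[symmetric] by (blast dest: core)
  moreover have "finite {x \<in> S. x - n \<in> first_gaps}"
    by (rule finite_subset[OF _ finite_movable[of n]]) (auto simp: first_gaps_def)
  ultimately show ?thesis
    unfolding movable_def
    by (simp only:, subst card_Un_disjoint[OF finite_movable])
       (auto simp: first_gaps_def diff_diff_add)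
qed

lemma first_gaps_step:
  "card {b \<in> first_gaps. b + (n - 2 * h) \<in> S}
    = card {b \<in> first_gaps. b + n \<in> S} + card {b \<in> first_gaps. b + n \<in> first_gaps}"
proof -
  have "b + (n - 2 * h) \<in> S \<longleftrightarrow> b + n \<in> S \<or> b + n \<in> first_gaps" for b
    using core[of "b + n"] by (auto simp: first_gaps_def add_diff_eq)
  then have "{b \<in> first_gaps. b + (n - 2 * h) \<in> S}
      = {b \<in> first_gaps. b + n \<in> S} \<union> {b \<in> first_gaps. b + n \<in> first_gaps}"
    by blast
  also have "card \<dots> = card {b \<in> first_gaps. b + n \<in> S} + card {b \<in> first_gaps. b + n \<in> first_gaps}"
  proof (rule card_Un_disjoint)
    show "{b \<in> first_gaps. b + n \<in> S} \<inter> {b \<in> first_gaps. b + n \<in> first_gaps} = {}"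
      by (auto simp: first_gaps_def)
  qed (use finite_first_gaps in simp_all)
  finally show ?thesis .
qed

lemma movable_second_difference:
  "movable (n - 2 * h) + movable (n + 2 * h)
    = 2 * movable n + card {b \<in> first_gaps. b + n \<in> first_gaps}"
  using movable_step[of "n - 2 * h"] movable_step[of n] first_gaps_step[of n] by simp

text \<open>\<open>movable (- m)\<close> and \<open>movable m\<close> are the sizes of the two set
  differences between \<open>S\<close> shifted up by \<open>m\<close> and \<open>S\<close>. Above a
  low cutoff the shifted set has exactly \<open>m\<close> more elements, because everything far
  below is occupied.\<close>

lemma movable_uminus:
  assumes "0 \<le> m"
  shows "int (movable (- m)) = int (movable m) + m"
proof -
  obtain N where N: "0 < N" "\<And>x. x \<in> S \<Longrightarrow> x < N" "\<And>x. x \<notin> S \<Longrightarrow> - N < x" by (rule bounds) blast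
  define L where "L = N + m"
  define Y where "Y = {x \<in> S. - L \<le> x}"
  define X where "X = {x. x - m \<in> S \<and> - L \<le> x}"
  have low: "x \<in> S" if "x \<le> - N" for x using N(3)[of x] that by linarith
  have finY: "finite Y"
    by (rule finite_subset[of _ "{- L..N}"]) (use N(2) in \<open>auto simp: Y_def less_imp_le\<close>)
  have finX: "finite X"
  proof (rule finite_subset)
    show "X \<subseteq> {- L..N + m}"
    proof
      fix x assume "x \<in> X"
      then show "x \<in> {- L..N + m}" using N(2)[of "x - m"] by (simp add: X_def)
    qed
  qed simp
  \<comment> \<open>The shift lifts the \<open>m\<close> positions just below the cutoff above it;
    all of them are occupied.\<close>
  have "bij_betw (\<lambda>x. x + m) (Y \<union> {- L - m..<- L}) X"
    using assms
    by (intro bij_betw_byWitness[where f' = "\<lambda>x. x - m"]) (auto simp: X_def Y_def L_def intro: low)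
  then have "card X = card (Y \<union> {- L - m..<- L})" by (simp add: bij_betw_same_card)
  also have "\<dots> = card Y + nat m"
    using finY assms by (subst card_Un_disjoint) (auto simp: Y_def)
  finally have cX: "card X = card Y + nat m" .
  have "X - Y = {x. x - m \<in> S \<and> x \<notin> S}"
  proof -
    have "- L \<le> x" if "x \<notin> S" for x using N(3)[OF that] assms by (simp add: L_def)
    then show ?thesis by (auto simp: X_def Y_def)
  qed
  moreover have "card {x. x - m \<in> S \<and> x \<notin> S} = movable (- m)"
    unfolding movable_def
    by (rule bij_betw_same_card[of "\<lambda>x. x - m"],
        rule bij_betw_byWitness[where f' = "\<lambda>x. x + m"]) auto
  moreover have "Y - X = {x \<in> S. x - m \<notin> S}"
  proof -
    have "- L \<le> x" if "x - m \<notin> S" for x using N(3)[OF that] assms by (simp add: L_def)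
    then show ?thesis by (auto simp: X_def Y_def)
  qed
  moreover have "card X = card (X - Y) + card (X \<inter> Y)"
    using finX card_mono[OF finX, of "X \<inter> Y"] by (simp add: card_Diff_subset_Int)
  moreover have "card Y = card (Y - X) + card (X \<inter> Y)"
    using finY card_mono[OF finY, of "X \<inter> Y"] by (simp add: card_Diff_subset_Int Int_commute)
  ultimately show ?thesis using cX assms by (simp add: movable_def)
qed

section \<open>The first gaps and their symmetry\<close>

lemma zero_in_first_gaps: "0 \<in> first_gaps"
proof -
  have "2 * h \<notin> S" using core[of "2 * h"] zero_notin by auto
  then show ?thesis using reflect[of "2 * h"] h_pos zero_notin by (simp add: first_gaps_def)
qed

text \<open>\<open>h\<close> in \<open>S\<close> would give \<open>- h\<close> in \<open>S\<close>
  by \<open>core\<close>, against \<open>reflect\<close>.\<close>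

lemma half_in_first_gaps: "h \<in> first_gaps"
proof -
  have "h \<notin> S" using core[of h] reflect[of h] h_pos by auto
  then show ?thesis using reflect[of h] h_pos by (simp add: first_gaps_def)
qed

text \<open>Reflection exchanges the two conditions that define a first gap. The gap
  \<open>0\<close> is exceptional: its partner \<open>2 * h\<close> would require \<open>0\<close>
  in \<open>S\<close>.\<close>

lemma first_gaps_reflect:
  assumes "b \<in> first_gaps" "b \<noteq> 0"
  shows "2 * h - b \<in> first_gaps"
proof -
  have b: "b \<notin> S" "b - 2 * h \<in> S" using assms by (auto simp: first_gaps_def)
  then have "b - 2 * h \<noteq> 0" using zero_notin by metis
  then have "2 * h - b \<notin> S" using reflect[of "b - 2 * h"] b by simp
  moreover have "- b \<in> S" using reflect[of b] b assms by blast
  ultimately show ?thesis by (simp add: first_gaps_def)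
qed

lemma half_notin_pos_gaps: "h \<notin> pos_gaps"
  using zero_notin by (simp add: pos_gaps_def first_gaps_def)

text \<open>Subtracting \<open>h\<close> turns the symmetry between \<open>b\<close> and
  \<open>2 * h - b\<close> into negation; \<open>0\<close> and \<open>- h\<close> come from the gaps
  \<open>h\<close> and \<open>0\<close>.\<close>

lemma shifted_first_gaps: "{b. b + h \<in> first_gaps} = pos_gaps \<union> uminus ` pos_gaps \<union> {0, - h}"
proof (intro equalityI subsetI)
  fix b assume "b \<in> {b. b + h \<in> first_gaps}"
  then have b: "b + h \<in> first_gaps" by simp
  show "b \<in> pos_gaps \<union> uminus ` pos_gaps \<union> {0, - h}"
  proof (cases "0 < b \<or> b = 0 \<or> b = - h")
    case True
    then show ?thesis using b by (auto simp: pos_gaps_def)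
  next
    case False
    then have "2 * h - (b + h) \<in> first_gaps" using b by (intro first_gaps_reflect) auto
    then have "- b \<in> pos_gaps" using False by (simp add: pos_gaps_def algebra_simps)
    then have "- (- b) \<in> uminus ` pos_gaps" by blast
    then show ?thesis by simp
  qed
next
  fix b assume "b \<in> pos_gaps \<union> uminus ` pos_gaps \<union> {0, - h}"
  then consider "b \<in> pos_gaps" | p where "b = - p" "p \<in> pos_gaps" | "b = 0" | "b = - h" by auto
  then show "b \<in> {b. b + h \<in> first_gaps}"
  proof cases
    case 2
    then show ?thesis using first_gaps_reflect[of "p + h"] h_pos
      by (simp add: pos_gaps_def algebra_simps)
  qed (use zero_in_first_gaps half_in_first_gaps in \<open>auto simp: pos_gaps_def\<close>)
qed

lemma card_first_gaps: "card first_gaps = 2 * card pos_gaps + 2"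
proof -
  have "bij_betw (\<lambda>b. b - h) first_gaps {b. b + h \<in> first_gaps}"
    by (rule bij_betw_byWitness[where f' = "\<lambda>b. b + h"]) auto
  then have "card first_gaps = card (pos_gaps \<union> uminus ` pos_gaps \<union> {0, - h})"
    using bij_betw_same_card shifted_first_gaps by metis
  also have "\<dots> = card (pos_gaps \<union> uminus ` pos_gaps) + card {0, - h}"
    using finite_pos_gaps h_pos half_notin_pos_gaps
    by (intro card_Un_disjoint) (auto simp: pos_gaps_def)
  also have "card (pos_gaps \<union> uminus ` pos_gaps) = card pos_gaps + card (uminus ` pos_gaps)"
    using finite_pos_gaps by (intro card_Un_disjoint) (auto simp: pos_gaps_def)
  also have "card (uminus ` pos_gaps) = card pos_gaps" by (intro card_image) simp
  finally show ?thesis using h_pos by simp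
qed

lemma card_first_gaps_differences:
  assumes "0 < n"
  shows "card {b \<in> first_gaps. b + n \<in> first_gaps} = 2 * count (root_values pos_gaps) n
     + of_bool (even n \<and> n div 2 + h \<in> first_gaps) + of_bool (n + 2 * h \<in> first_gaps)
     + of_bool (n \<in> first_gaps)"
proof -
  let ?Q = "{b. b + h \<in> first_gaps}"
  have "card {b \<in> first_gaps. b + n \<in> first_gaps} = card {b \<in> ?Q. b + n \<in> ?Q}"
    by (rule bij_betw_same_card[of "\<lambda>b. b - h"],
        rule bij_betw_byWitness[where f' = "\<lambda>b. b + h"]) (auto simp: algebra_simps)
  also have "\<dots> = 2 * count (root_values pos_gaps) n
     + of_bool (even n \<and> n div 2 \<in> ?Q) + of_bool (n + h \<in> ?Q) + of_bool (n - h \<in> ?Q)"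
    by (rule card_differences_signed_set[OF finite_pos_gaps _ h_pos half_notin_pos_gaps assms
          shifted_first_gaps]) (simp add: pos_gaps_def)
  finally show ?thesis by (simp add: algebra_simps)
qed

text \<open>
  The reflection \<open>(x, y) \<mapsto> (- y, - x)\<close> preserves gaps and exchanges the two sides. It is undefined
  only on the pairs \<open>(x, 0)\<close>, and the pairs \<open>(x, - x)\<close> stay on their side.
\<close>

lemma side_gaps:
  "image_mset gap (mset_set {p \<in> inversions S. side p = 1})
    = image_mset gap (mset_set {p \<in> inversions S. side p = - 1})
      + image_mset (\<lambda>x. 2 * x) (mset_set {x \<in> S. 0 < x}) + mset_set {x \<in> S. 0 < x}"
proof -
  let ?M = "{p \<in> inversions S. side p = - 1}" and ?X = "{x \<in> S. 0 < x}"
  let ?f = "\<lambda>p. (- snd p, - fst p)"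
  have eq: "{p \<in> inversions S. side p = 1}
      = (?f ` ?M \<union> (\<lambda>x. (x, - x)) ` ?X) \<union> (\<lambda>x. (x, 0)) ` ?X" (is "?L = ?R")
  proof (intro equalityI subsetI)
    fix p assume "p \<in> ?L"
    then obtain x y where p: "p = (x, y)" "x \<in> S" "y \<notin> S" "y < x" "0 \<le> x + y"
      by (auto simp: inversions_def side_def split: if_splits)
    consider "y = 0" | "y = - x" | "y \<noteq> 0" "0 < x + y" using p by linarith
    then show "p \<in> ?R"
    proof cases
      case 3
      have "- y \<in> S" "- x \<notin> S" using reflect[of y] reflect[of x] 3 p zero_notin by auto
      then have "(- y, - x) \<in> ?M" using p 3 by (auto simp: inversions_def side_def)
      then have "?f (- y, - x) \<in> ?f ` ?M" by blast
      then show ?thesis using p by simp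
    qed (use p in auto)
  next
    fix p assume "p \<in> ?R"
    then consider x y where "p = (- y, - x)" "x \<in> S" "y \<notin> S" "y < x" "x + y < 0"
      | x where "p = (x, - x)" "x \<in> S" "0 < x" | x where "p = (x, 0)" "x \<in> S" "0 < x"
      by (auto simp: inversions_def side_def split: if_splits)
    then show "p \<in> ?L"
    proof cases
      case 1
      then have "- y \<in> S" "- x \<notin> S" using reflect[of y] reflect[of x] zero_notin by force+
      then show ?thesis using 1 by (auto simp: inversions_def side_def)
    next
      case 2
      then have "- x \<notin> S" using reflect[of x] by simp
      then show ?thesis using 2 by (auto simp: inversions_def side_def)
    qed (use zero_notin in \<open>auto simp: inversions_def side_def\<close>)
  qed
  have finX: "finite ?X" by (rule finite_positive)
  have finM: "finite ?M" using finite_inversions by simp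
  have d1: "?f ` ?M \<inter> (\<lambda>x. (x, - x)) ` ?X = {}"
    by (auto simp: side_def)
  have d2: "(?f ` ?M \<union> (\<lambda>x. (x, - x)) ` ?X) \<inter> (\<lambda>x. (x, 0)) ` ?X = {}"
    using zero_notin by (auto simp: inversions_def)
  have i1: "inj_on ?f ?M" by (auto simp: inj_on_def prod_eq_iff)
  have i2: "inj_on (\<lambda>x::int. (x, - x)) ?X" and i3: "inj_on (\<lambda>x::int. (x, 0::int)) ?X"
    by (auto simp: inj_on_def)
  have "mset_set {p \<in> inversions S. side p = 1} = image_mset ?f (mset_set ?M)
      + image_mset (\<lambda>x. (x, - x)) (mset_set ?X) + image_mset (\<lambda>x. (x, 0)) (mset_set ?X)"
    unfolding eq
    by (subst mset_set_Union[OF _ _ d2], use finM finX in simp, use finX in simp,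
        subst mset_set_Union[OF _ _ d1], use finM in simp, use finX in simp)
       (simp only: image_mset_mset_set[OF i1] image_mset_mset_set[OF i2] image_mset_mset_set[OF i3])
  then show ?thesis by (simp add: image_mset.compositionality o_def gap_def[abs_def])
qed

section \<open>Counting hooks by length and side\<close>

lemma card_inversions_gap:
  assumes "0 < m"
  shows "card {p \<in> inversions S. gap p = m} = movable m"
  unfolding movable_def
  by (rule bij_betw_same_card[of fst], rule bij_betw_byWitness[where f' = "\<lambda>x. (x, x - m)"])
     (use assms in \<open>auto simp: inversions_def gap_def\<close>)

lemma card_side_eq:
  assumes "0 < m"
  shows "card {p \<in> inversions S. gap p = m \<and> side p = 1}
    = card {p \<in> inversions S. gap p = m \<and> side p = - 1}
      + of_bool (even m \<and> m div 2 \<in> S) + of_bool (m \<in> S)"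
proof -
  have "{x. (x \<in> S \<and> 0 < x) \<and> 2 * x = m} = (if even m \<and> m div 2 \<in> S then {m div 2} else {})"
    using assms by auto
  then have "card {x. (x \<in> S \<and> 0 < x) \<and> 2 * x = m} = of_bool (even m \<and> m div 2 \<in> S)" by simp
  moreover have "{p. (p \<in> inversions S \<and> side p = s) \<and> gap p = m}
      = {p \<in> inversions S. gap p = m \<and> side p = s}" for s by auto
  ultimately show ?thesis
    using arg_cong[OF side_gaps, of "\<lambda>M. count M m"] assms finite_inversions finite_positive
    by (simp add: count_image_mset_set)
qed

text \<open>The two counts add up to \<open>movable m\<close>, and \<open>card_side_eq\<close> gives
  their difference.\<close>

lemma card_side:
  assumes "0 < m"
  shows "2 * int (card {p \<in> inversions S. gap p = m \<and> side p = 1})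
      = int (movable m) + of_bool (even m \<and> m div 2 \<in> S) + of_bool (m \<in> S)"
    and "2 * int (card {p \<in> inversions S. gap p = m \<and> side p = - 1})
      = int (movable m) - of_bool (even m \<and> m div 2 \<in> S) - of_bool (m \<in> S)"
proof -
  have "{p \<in> inversions S. gap p = m} = {p \<in> inversions S. gap p = m \<and> side p = 1}
      \<union> {p \<in> inversions S. gap p = m \<and> side p = - 1}" by (auto simp: side_def)
  moreover have "card ({p \<in> inversions S. gap p = m \<and> side p = 1}
      \<union> {p \<in> inversions S. gap p = m \<and> side p = - 1})
    = card {p \<in> inversions S. gap p = m \<and> side p = 1}
      + card {p \<in> inversions S. gap p = m \<and> side p = - 1}"
    by (rule card_Un_disjoint) (use finite_inversions in auto)
  ultimately have "movable m = card {p \<in> inversions S. gap p = m \<and> side p = 1}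
      + card {p \<in> inversions S. gap p = m \<and> side p = - 1}"
    using card_inversions_gap[OF assms] by simp
  then show "2 * int (card {p \<in> inversions S. gap p = m \<and> side p = 1})
      = int (movable m) + of_bool (even m \<and> m div 2 \<in> S) + of_bool (m \<in> S)"
    "2 * int (card {p \<in> inversions S. gap p = m \<and> side p = - 1})
      = int (movable m) - of_bool (even m \<and> m div 2 \<in> S) - of_bool (m \<in> S)"
    using card_side_eq[OF assms] by simp_all
qed

lemma gap_pos: "p \<in> inversions S \<Longrightarrow> 0 < gap p"
  by (auto simp: inversions_def gap_def)

lemma card_side_nonpos:
  assumes "m \<le> 0"
  shows "card {p \<in> inversions S. gap p = m \<and> side p = s} = 0"
proof -
  have "{p \<in> inversions S. gap p = m \<and> side p = s} = {}" using gap_pos assms by force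
  then show ?thesis by (simp only: card.empty)
qed

text \<open>By \<open>card_side\<close> the left count becomes a second difference of
  \<open>movable\<close> with corrections, which cancel against the extra terms of
  \<open>card_first_gaps_differences\<close>. The conditional term does not depend on
  \<open>S\<close>: it is the contribution of the empty partition.\<close>

lemma card_reflected_gaps:
  assumes n: "0 < n"
  shows "2 * int (card {p \<in> inversions S. \<bar>gap p - side p * (2 * h)\<bar> = n})
      + (if n < 2 * h then 2 * h - n - 1 - of_bool (even n) else 0)
    = 2 * int (card {p \<in> inversions S. gap p = n}) + 2 * int (count (root_values pos_gaps) n)"
proof -
  define N where "N s m = int (card {p \<in> inversions S. gap p = m \<and> side p = s})" for s m
  \<comment> \<open>For \<open>m > 0\<close> this is the excess of side \<open>1\<close> over side
    \<open>- 1\<close> among the pairs with gap \<open>m\<close>.\<close>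
  define q :: "int \<Rightarrow> int" where "q m = of_bool (even m \<and> m div 2 \<in> S) + of_bool (m \<in> S)" for m
  let ?D = "card {b \<in> first_gaps. b + n \<in> first_gaps}"
  have N: "2 * N 1 m = int (movable m) + q m" "2 * N (- 1) m = int (movable m) - q m" if "0 < m" for m
    using card_side[OF that] by (simp_all add: N_def q_def)
  have N0: "N s m = 0" if "m \<le> 0" for s m
    using card_side_nonpos[OF that] by (simp add: N_def)
  \<comment> \<open>The absolute value \<open>n\<close> arises from the gaps
    \<open>n + 2 * h\<close> and \<open>2 * h - n\<close> on side \<open>1\<close>, and from the gap
    \<open>n - 2 * h\<close> on side \<open>- 1\<close>.\<close>
  have A: "int (card {p \<in> inversions S. \<bar>gap p - side p * (2 * h)\<bar> = n})
      = N 1 (n + 2 * h) + N (- 1) (n - 2 * h) + N 1 (2 * h - n)"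
  proof -
    let ?H = "\<lambda>s m. {p \<in> inversions S. gap p = m \<and> side p = s}"
    have "{p \<in> inversions S. \<bar>gap p - side p * (2 * h)\<bar> = n}
        = ?H 1 (n + 2 * h) \<union> ?H (- 1) (n - 2 * h) \<union> ?H 1 (2 * h - n)"
    proof (intro set_eqI)
      fix p
      show "p \<in> {p \<in> inversions S. \<bar>gap p - side p * (2 * h)\<bar> = n}
        \<longleftrightarrow> p \<in> ?H 1 (n + 2 * h) \<union> ?H (- 1) (n - 2 * h) \<union> ?H 1 (2 * h - n)"
        using n h_pos gap_pos[of p] by (cases "side p = 1") (auto simp: side_def)
    qed
    moreover have "card (?H 1 (n + 2 * h) \<union> ?H (- 1) (n - 2 * h) \<union> ?H 1 (2 * h - n))
        = card (?H 1 (n + 2 * h) \<union> ?H (- 1) (n - 2 * h)) + card (?H 1 (2 * h - n))"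
    proof (rule card_Un_disjoint)
      show "(?H 1 (n + 2 * h) \<union> ?H (- 1) (n - 2 * h)) \<inter> ?H 1 (2 * h - n) = {}"
        using n by auto
    qed (use finite_inversions in simp_all)
    moreover have "card (?H 1 (n + 2 * h) \<union> ?H (- 1) (n - 2 * h))
        = card (?H 1 (n + 2 * h)) + card (?H (- 1) (n - 2 * h))"
    proof (rule card_Un_disjoint)
      have "p \<notin> ?H (- 1) m'" if "p \<in> ?H 1 m" for p m m' using that by simp
      then show "?H 1 (n + 2 * h) \<inter> ?H (- 1) (n - 2 * h) = {}" by blast
    qed (use finite_inversions in simp_all)
    ultimately show ?thesis unfolding N_def by (simp only: of_nat_add)
  qed
  \<comment> \<open>Going up in steps of \<open>2 * h\<close>, membership in \<open>S\<close> can
    only be lost, and the loss happens at a first gap.\<close>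
  have q: "q (n - 2 * h) - q (n + 2 * h) = of_bool (even n \<and> n div 2 + h \<in> first_gaps)
      + of_bool (n + 2 * h \<in> first_gaps) + of_bool (n \<in> first_gaps)"
  proof -
    have div: "(n - 2 * h) div 2 = n div 2 - h" "(n + 2 * h) div 2 = n div 2 + h" by simp_all
    have mono: "n div 2 + h \<in> S \<Longrightarrow> n div 2 - h \<in> S" "n \<in> S \<Longrightarrow> n - 2 * h \<in> S"
      "n + 2 * h \<in> S \<Longrightarrow> n \<in> S"
      using core[of "n div 2 + h"] core[of n] core[of "n + 2 * h"] by simp_all
    have "of_bool (n div 2 - h \<in> S) - of_bool (n div 2 + h \<in> S)
        = (of_bool (n div 2 + h \<in> first_gaps) :: int)"
      using mono(1) by (auto simp: first_gaps_def)
    moreover have "of_bool (n - 2 * h \<in> S) - of_bool (n + 2 * h \<in> S)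
        = (of_bool (n + 2 * h \<in> first_gaps) + of_bool (n \<in> first_gaps) :: int)"
      using mono(2,3) by (auto simp: first_gaps_def)
    ultimately show ?thesis unfolding q_def div by (cases "even n") simp_all
  qed
  have D: "int (movable (n - 2 * h)) + int (movable (n + 2 * h)) - 2 * int (movable n)
      = 2 * int (count (root_values pos_gaps) n) + (q (n - 2 * h) - q (n + 2 * h))"
    using arg_cong[OF movable_second_difference[of n], of int] card_first_gaps_differences[OF n]
    unfolding q by simp
  have p1: "2 * N 1 (n + 2 * h) = int (movable (n + 2 * h)) + q (n + 2 * h)"
    using N(1)[of "n + 2 * h"] n h_pos by simp
  define w :: int where "w = (if n < 2 * h then 2 * h - n - 1 - of_bool (even n) else 0)"
  have "2 * (N 1 (n + 2 * h) + N (- 1) (n - 2 * h) + N 1 (2 * h - n)) + w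
      = 2 * int (movable n) + 2 * int (count (root_values pos_gaps) n)"
  proof -
    consider "2 * h < n" | "n = 2 * h" | "n < 2 * h" by linarith
    then show ?thesis
    proof cases
      case 1
      then have "w = 0" "N 1 (2 * h - n) = 0" "2 * N (- 1) (n - 2 * h) = int (movable (n - 2 * h)) - q (n - 2 * h)"
        using N(2)[of "n - 2 * h"] N0[of "2 * h - n" 1] by (simp_all add: w_def)
      then show ?thesis using D p1 by simp
    next
      case 2
      have "movable (n - 2 * h) = 0" "q (n - 2 * h) = 0" "w = 0"
        using zero_notin 2 by (simp_all add: movable_def q_def w_def)
      moreover have "N (- 1) (n - 2 * h) = 0" "N 1 (2 * h - n) = 0" using 2 by (simp_all add: N0)
      ultimately show ?thesis using D p1 by simp
    next
      case 3
      \<comment> \<open>Here \<open>movable\<close> and \<open>q\<close> occur at the negative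
        argument \<open>n - 2 * h\<close>; \<open>movable_uminus\<close> and \<open>reflect\<close>
        trade it for \<open>2 * h - n\<close>, and the constants that arise add up to
        \<open>w\<close>.\<close>
      have "even (2 * h - n) \<longleftrightarrow> even n" "even (n - 2 * h) \<longleftrightarrow> even n" by simp_all
      moreover have "(2 * h - n) div 2 = - ((n - 2 * h) div 2)" "(n - 2 * h) div 2 \<noteq> 0" if "even n"
        using 3 that by (auto elim!: evenE)
      ultimately have "q (2 * h - n) + q (n - 2 * h) = 1 + of_bool (even n)"
        using reflect[of "n - 2 * h"] reflect[of "(n - 2 * h) div 2"] 3
        by (cases "even n"; cases "n - 2 * h \<in> S"; cases "(n - 2 * h) div 2 \<in> S")
           (simp_all add: q_def)
      moreover have "int (movable (n - 2 * h)) = int (movable (2 * h - n)) + (2 * h - n)"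
        using movable_uminus[of "2 * h - n"] 3 by simp
      moreover have "w = 2 * h - n - 1 - of_bool (even n)" using 3 by (simp add: w_def)
      moreover have "2 * N 1 (2 * h - n) = int (movable (2 * h - n)) + q (2 * h - n)"
        using N(1)[of "2 * h - n"] 3 by simp
      moreover have "N (- 1) (n - 2 * h) = 0" using 3 by (simp add: N0)
      ultimately show ?thesis using D p1 by simp
    qed
  qed
  then show ?thesis unfolding A w_def card_inversions_gap[OF n] .
qed

end

section \<open>The empty partition and the multiset identity\<close>

lemma doubled_maya_negative:
  assumes "0 < h"
  shows "doubled_maya {x. x < 0} h"
proof
  show "bdd_above {x::int. x < 0}" by (rule bdd_aboveI[of _ 0]) simp
qed (use assms in auto)

text \<open>The Maya set of the empty partition has no inversions, so the previous identity evaluates the count.\<close>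

lemma count_root_values_staircase:
  assumes "0 < h" "0 < n"
  shows "2 * int (count (root_values {1..<h}) n)
    = (if n < 2 * h then 2 * h - n - 1 - of_bool (even n) else 0)"
proof -
  interpret doubled_maya "{x. x < 0}" h by (rule doubled_maya_negative) fact
  have "inversions {x. x < 0} = {}" by (auto simp: inversions_def)
  moreover have "pos_gaps = {1..<h}" by (auto simp: pos_gaps_def first_gaps_def)
  ultimately show ?thesis using card_reflected_gaps[OF assms(2)] by simp
qed

lemma count_root_values_nonpos:
  assumes "finite P" "\<And>p. p \<in> P \<Longrightarrow> 0 < p" "n \<le> 0"
  shows "count (root_values P) n = 0"
proof -
  have "n \<notin> P" using assms(2)[of n] assms(3) by linarith
  moreover have "{p \<in> P. n - p \<in> P \<and> n - p < p} = {}"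
  proof -
    have False if "p \<in> P" "n - p \<in> P" for p
      using assms(2)[OF that(1)] assms(2)[OF that(2)] assms(3) by linarith
    then show ?thesis by blast
  qed
  ultimately show ?thesis
    using assms(3) by (simp only: count_root_values[OF assms(1)] card.empty) simp
qed

context doubled_maya begin

text \<open>Hence \<open>gap p - side p * (2 * h)\<close> is never \<open>0\<close>, and its
  absolute value is positive.\<close>

lemma gap_ne:
  assumes "p \<in> inversions S"
  shows "gap p \<noteq> 2 * h"
proof
  assume "gap p = 2 * h"
  then have "snd p = fst p - 2 * h" by (simp add: gap_def)
  then show False using assms core[of "fst p"] by (simp add: inversions_def case_prod_beta)
qed

text \<open>Multiplicities of positive \<open>n\<close> are compared by
  \<open>card_reflected_gaps\<close>; nonpositive \<open>n\<close> occur on neither side. The set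
  \<open>{1..<h}\<close> is \<open>pos_gaps\<close> of the empty partition.\<close>

lemma reflected_gaps:
  "image_mset (\<lambda>p. \<bar>gap p - side p * (2 * h)\<bar>) (mset_set (inversions S)) + root_values {1..<h}
    = image_mset gap (mset_set (inversions S)) + root_values pos_gaps"
proof (rule multiset_eqI)
  fix n
  show "count (image_mset (\<lambda>p. \<bar>gap p - side p * (2 * h)\<bar>) (mset_set (inversions S))
      + root_values {1..<h}) n
    = count (image_mset gap (mset_set (inversions S)) + root_values pos_gaps) n"
  proof (cases "0 < n")
    case True
    have "int (card {p \<in> inversions S. \<bar>gap p - side p * (2 * h)\<bar> = n}) + int (count (root_values {1..<h}) n)
      = int (card {p \<in> inversions S. gap p = n}) + int (count (root_values pos_gaps) n)"
      using card_reflected_gaps[OF True] count_root_values_staircase[OF h_pos True] by linarith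
    then show ?thesis
      using finite_inversions by (simp add: count_image_mset_set)
  next
    case False
    have "\<bar>gap p - side p * (2 * h)\<bar> \<noteq> n" "gap p \<noteq> n" if "p \<in> inversions S" for p
      using gap_pos[OF that] gap_ne[OF that] False h_pos by (auto simp: side_def)
    then have "{p \<in> inversions S. \<bar>gap p - side p * (2 * h)\<bar> = n} = {}" "{p \<in> inversions S. gap p = n} = {}"
      by auto
    moreover have "count (root_values {1..<h}) n = 0" "count (root_values pos_gaps) n = 0"
      using False finite_pos_gaps by (auto intro!: count_root_values_nonpos simp: pos_gaps_def)
    ultimately show ?thesis
      by (simp only: count_union count_image_mset_set[OF finite_inversions] card.empty)
  qed
qed

end

section \<open>Maya sets of partitions\<close>

definition bead :: "nat list \<Rightarrow> nat \<Rightarrow> int" where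
  "bead lam i = int (part lam i) - int i"

text \<open>The holes are the integers missing from the Maya set, indexed by columns. The offset
  makes \<open>bead lam i - hole lam j\<close> the hook length of \<open>(i, j)\<close>.\<close>

definition hole :: "nat list \<Rightarrow> nat \<Rightarrow> int" where
  "hole lam j = int j - 1 - int (conj_part lam j)"

definition maya :: "nat list \<Rightarrow> int set" where
  "maya lam = bead lam ` {1..}"

lemma part_beyond: "length lam < i \<Longrightarrow> part lam i = 0"
  by (simp add: part_def)

lemma part_antimono:
  assumes "is_partition lam" "1 \<le> i" "i \<le> k"
  shows "part lam k \<le> part lam i"
proof (cases "k \<le> length lam \<and> i < k")
  case True
  then have "lam ! (i - 1) \<ge> lam ! (k - 1)"
    using assms by (intro sorted_wrt_nth_less[of "(\<ge>)"]) (auto simp: is_partition_def)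
  then show ?thesis using True assms by (simp add: part_def)
next
  case False
  then show ?thesis using assms by (cases "i = k") (auto simp: part_beyond)
qed

text \<open>The rows of length at least \<open>j\<close> form an initial segment.\<close>

lemma le_part_iff:
  assumes "is_partition lam" "1 \<le> i" "1 \<le> j"
  shows "j \<le> part lam i \<longleftrightarrow> i \<le> conj_part lam j"
proof
  let ?A = "{i. 1 \<le> i \<and> i \<le> length lam \<and> j \<le> part lam i}"
  have fin: "finite ?A" by (rule finite_subset[of _ "{..length lam}"]) auto
  {
    assume j: "j \<le> part lam i"
    have "i \<le> length lam" using part_beyond[of lam i] j assms by (cases "i \<le> length lam") auto
    then have "{1..i} \<subseteq> ?A" using part_antimono[OF assms(1)] j by (auto intro: order_trans)
    then have "card {1..i} \<le> card ?A" by (rule card_mono[OF fin])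
    then show "i \<le> conj_part lam j" by (simp add: conj_part_def)
  }
  {
    assume i: "i \<le> conj_part lam j"
    show "j \<le> part lam i"
    proof (rule ccontr)
      assume "\<not> j \<le> part lam i"
      then have "k < i" if "k \<in> ?A" for k
        using that part_antimono[OF assms(1,2), of k] by (cases "i \<le> k") auto
      then have "?A \<subseteq> {1..<i}" by auto
      then have "card ?A \<le> card {1..<i}" by (rule card_mono[rotated]) simp
      then show False using i assms(2) by (simp add: conj_part_def)
    qed
  }
qed

lemma bead_strict_antimono:
  assumes "is_partition lam" "1 \<le> i" "i < k"
  shows "bead lam k < bead lam i"
  using part_antimono[OF assms(1,2), of k] assms(3) by (simp add: bead_def)

lemma bead_le_iff:
  assumes "is_partition lam" "1 \<le> i" "1 \<le> k"
  shows "bead lam k \<le> bead lam i \<longleftrightarrow> i \<le> k"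
  using bead_strict_antimono[OF assms(1,2), of k] bead_strict_antimono[OF assms(1,3), of i]
  by (cases i k rule: linorder_cases) auto

lemma hole_strict_mono:
  assumes "j < k"
  shows "hole lam j < hole lam k"
proof -
  have "conj_part lam k \<le> conj_part lam j"
    unfolding conj_part_def using assms
    by (intro card_mono) (auto intro: finite_subset[of _ "{..length lam}"])
  then show ?thesis using assms by (simp add: hole_def)
qed

text \<open>Bead minus hole is \<open>(part lam i - j) + (conj_part lam j - i) + 1\<close>. By
  \<open>le_part_iff\<close> both brackets are nonnegative inside the diagram and both are negative
  outside.\<close>

lemma box_iff_hole_less_bead:
  assumes "is_partition lam" "1 \<le> i" "1 \<le> j"
  shows "j \<le> part lam i \<longleftrightarrow> hole lam j < bead lam i"
    and "hole lam j \<noteq> bead lam i"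
  using le_part_iff[OF assms] by (cases "j \<le> part lam i"; simp add: bead_def hole_def)+

lemma hole_notin_maya: "is_partition lam \<Longrightarrow> 1 \<le> j \<Longrightarrow> hole lam j \<notin> maya lam"
  using box_iff_hole_less_bead(2) by (fastforce simp: maya_def)

text \<open>If \<open>i\<close> beads lie above \<open>z\<close>, then column
  \<open>z + 1 + i\<close> has exactly \<open>i\<close> boxes, which makes \<open>z\<close> its
  hole.\<close>

lemma notin_maya_imp_hole:
  assumes lam: "is_partition lam" and z: "z \<notin> maya lam"
  obtains j where "1 \<le> j" "z = hole lam j"
proof -
  define P where "P k \<longleftrightarrow> 1 \<le> k \<and> bead lam k < z" for k
  \<comment> \<open>Rows beyond the last part have bead \<open>- k\<close>, so some bead lies below
    \<open>z\<close>.\<close>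
  have "P (length lam + 1 + nat \<bar>z\<bar>)"
    by (auto simp: P_def bead_def part_beyond)
  then have k: "P (Least P)" by (rule LeastI)
  have min: "\<not> P m" if "m < Least P" for m using that by (rule not_less_Least)
  define i where "i = Least P - 1"
  have i: "Least P = i + 1" using k by (simp add: i_def P_def)
  define j where "j = nat (z + 1 + int i)"
  have less: "int (part lam (i + 1)) < z + 1 + int i"
    using k unfolding i by (simp add: P_def bead_def)
  then have j: "int j = z + 1 + int i" "1 \<le> j" by (auto simp: j_def)
  have "\<not> j \<le> part lam (i + 1)" using less j by linarith
  then have "conj_part lam j \<le> i" using le_part_iff[OF lam _ j(2), of "i + 1"] by auto
  moreover have "i \<le> conj_part lam j"
  proof (cases "i = 0")
    case False
    then have "\<not> bead lam i < z" using min[of i] i by (auto simp: P_def)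
    moreover have "bead lam i \<noteq> z" using z False by (auto simp: maya_def)
    ultimately have "j \<le> part lam i" using j by (simp add: bead_def)
    then show ?thesis using le_part_iff[OF lam _ j(2), of i] False by simp
  qed simp
  ultimately show thesis using that[of j] j by (simp add: hole_def)
qed

lemma bij_betw_boxes_inversions:
  assumes lam: "is_partition lam"
  shows "bij_betw (\<lambda>(i, j). (bead lam i, hole lam j)) (boxes lam) (inversions (maya lam))"
proof (rule bij_betw_imageI)
  show "inj_on (\<lambda>(i, j). (bead lam i, hole lam j)) (boxes lam)"
  proof (rule inj_onI, clarify)
    fix i j i' j'
    assume "(i, j) \<in> boxes lam" "(i', j') \<in> boxes lam" "bead lam i = bead lam i'" "hole lam j = hole lam j'"
    then show "i = i' \<and> j = j'"
      using bead_le_iff[OF lam, of i i'] bead_le_iff[OF lam, of i' i]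
        hole_strict_mono[of j j' lam] hole_strict_mono[of j' j lam]
      by (cases j j' rule: linorder_cases) (auto simp: boxes_def)
  qed
  show "(\<lambda>(i, j). (bead lam i, hole lam j)) ` boxes lam = inversions (maya lam)" (is "?L = ?R")
  proof (intro equalityI subsetI)
    fix p assume "p \<in> ?L"
    then obtain i j where "p = (bead lam i, hole lam j)" "1 \<le> i" "1 \<le> j" "j \<le> part lam i"
      by (auto simp: boxes_def)
    then show "p \<in> ?R"
      using box_iff_hole_less_bead(1)[OF lam, of i j] hole_notin_maya[OF lam, of j]
      by (auto simp: inversions_def maya_def)
  next
    fix p assume "p \<in> ?R"
    then obtain x y where p: "p = (x, y)" "x \<in> maya lam" "y \<notin> maya lam" "y < x"
      by (auto simp: inversions_def)
    obtain i where i: "1 \<le> i" "x = bead lam i" using p by (auto simp: maya_def)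
    obtain j where j: "1 \<le> j" "y = hole lam j" using notin_maya_imp_hole[OF lam p(3)] by blast
    have "(i, j) \<in> boxes lam"
      using box_iff_hole_less_bead(1)[OF lam i(1) j(1)] i j p by (simp add: boxes_def)
    then show "p \<in> ?L" using p i j by force
  qed
qed

lemma hook_eq_gap: "hook lam (i, j) = gap (bead lam i, hole lam j)"
  by (simp add: hook_def gap_def bead_def hole_def)

section \<open>Doubled distinct partitions\<close>

lemma le_durfee_iff:
  assumes lam: "is_partition lam" and i: "1 \<le> i"
  shows "i \<le> durfee lam \<longleftrightarrow> i \<le> part lam i"
proof -
  let ?T = "{s. s \<le> part lam s}"
  have "s \<le> length lam" if "s \<in> ?T" for s
    using that part_beyond[of lam s] by (cases "s \<le> length lam") auto
  then have fin: "finite ?T" by (auto intro: finite_subset[of _ "{..length lam}"])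
  \<comment> \<open>The set contains \<open>0\<close>, so the maximum exists even for the empty
    partition.\<close>
  have "Max ?T \<in> ?T" by (rule Max_in[OF fin]) (auto intro: exI[of _ 0])
  then have "i \<le> part lam i" if "i \<le> Max ?T"
    using part_antimono[OF lam i that] that by simp
  then show ?thesis using Max_ge[OF fin, of i] by (auto simp: durfee_def)
qed

text \<open>The source of the reflection symmetry: \<open>part lam i - i\<close> equals
  \<open>conj_part lam i + 1 - i\<close> up to the Durfee size.\<close>

lemma DD_bead_hole:
  assumes "DD lam" "1 \<le> i" "i \<le> part lam i"
  shows "bead lam i = - hole lam i" "0 < bead lam i"
proof -
  have lam: "is_partition lam" using assms by (simp add: DD_def)
  have "part lam i = conj_part lam i + 1"
    using assms le_durfee_iff[OF lam] by (auto simp: DD_def)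
  moreover have "i \<le> conj_part lam i" using le_part_iff[OF lam assms(2,2)] assms(3) by simp
  ultimately show "bead lam i = - hole lam i" "0 < bead lam i" by (simp_all add: bead_def hole_def)
qed

lemma bead_hole_beyond_durfee:
  assumes "is_partition lam" "1 \<le> i" "\<not> i \<le> part lam i"
  shows "bead lam i < 0" "0 \<le> hole lam i"
  using assms le_part_iff[OF assms(1,2,2)] by (simp_all add: bead_def hole_def)

lemma DD_zero_notin_maya:
  assumes "DD lam"
  shows "0 \<notin> maya lam"
proof
  assume "0 \<in> maya lam"
  then obtain i where "1 \<le> i" "bead lam i = 0" by (auto simp: maya_def)
  then show False
    using DD_bead_hole(2)[OF assms, of i] bead_hole_beyond_durfee(1)[of lam i] assms
    by (cases "i \<le> part lam i") (auto simp: DD_def)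
qed

text \<open>A positive bead belongs to a row that meets the diagonal, and a negative hole to such a
  column; there \<open>DD_bead_hole\<close> matches the two.\<close>

lemma DD_pos_reflect:
  assumes "DD lam" "0 < x"
  shows "- x \<in> maya lam \<longleftrightarrow> x \<notin> maya lam"
proof -
  have lam: "is_partition lam" using assms by (simp add: DD_def)
  have "- x \<notin> maya lam" if "x \<in> maya lam"
  proof -
    obtain i where i: "1 \<le> i" "x = bead lam i" using \<open>x \<in> maya lam\<close> by (auto simp: maya_def)
    then have "i \<le> part lam i"
      using bead_hole_beyond_durfee(1)[OF lam, of i] assms(2) by (cases "i \<le> part lam i") auto
    then have "- x = hole lam i" using DD_bead_hole(1)[OF assms(1), of i] i by simp
    then show ?thesis using hole_notin_maya[OF lam] i by simp
  qed
  moreover have "x \<in> maya lam" if neg: "- x \<notin> maya lam"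
  proof -
    obtain j where j: "1 \<le> j" "- x = hole lam j" using notin_maya_imp_hole[OF lam neg] by blast
    then have "j \<le> part lam j"
      using bead_hole_beyond_durfee(2)[OF lam, of j] assms(2) by (cases "j \<le> part lam j") auto
    then have "x = bead lam j" using DD_bead_hole(1)[OF assms(1), of j] j by simp
    then show ?thesis using j by (simp add: maya_def)
  qed
  ultimately show ?thesis by blast
qed

text \<open>If column \<open>j\<close> meets the diagonal, bead plus hole is
  \<open>bead lam i - bead lam j\<close>, nonnegative exactly for \<open>i \<le> j\<close>.
  Otherwise the hole and the bead are both nonnegative, and the box lies right of the
  diagonal.\<close>

lemma eps_eq_side:
  assumes "DD lam" "(i, j) \<in> boxes lam"
  shows "eps (i, j) = side (bead lam i, hole lam j)"
proof -
  have lam: "is_partition lam" using assms by (simp add: DD_def)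
  have ij: "1 \<le> i" "1 \<le> j" "j \<le> part lam i" using assms by (auto simp: boxes_def)
  show ?thesis
  proof (cases "j \<le> part lam j")
    case True
    then show ?thesis
      using DD_bead_hole(1)[OF assms(1) ij(2)] bead_le_iff[OF lam ij(1,2)]
      by (auto simp: eps_def side_def)
  next
    case False
    have pos: "0 \<le> hole lam j" "0 < bead lam i"
      using bead_hole_beyond_durfee(2)[OF lam ij(2) False] box_iff_hole_less_bead(1)[OF lam ij(1,2)] ij
      by auto
    have "i < j"
      using False part_antimono[OF lam ij(2), of i] ij(3) by (cases "j \<le> i") auto
    then show ?thesis using pos by (simp add: eps_def side_def)
  qed
qed

lemma bdd_above_maya:
  assumes "is_partition lam"
  shows "bdd_above (maya lam)"
proof (rule bdd_aboveI[of _ "bead lam 1"])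
  fix x assume "x \<in> maya lam"
  then show "x \<le> bead lam 1" using bead_le_iff[OF assms] by (auto simp: maya_def)
qed

text \<open>A failure of \<open>core\<close> would be an inversion of gap \<open>2 * h\<close>,
  hence a box of hook length \<open>g\<close>.\<close>

lemma doubled_maya_DD_core:
  assumes "DD_core g lam" "int g = 2 * h" "0 < h"
  shows "doubled_maya (maya lam) h"
proof
  have DD: "DD lam" and core: "is_core g lam" using assms by (simp_all add: DD_core_def)
  then have lam: "is_partition lam" by (simp add: DD_def)
  show "- x \<in> maya lam \<longleftrightarrow> x \<notin> maya lam" if "x \<noteq> 0" for x
    using DD_pos_reflect[OF DD, of x] DD_pos_reflect[OF DD, of "- x"] that by fastforce
  show "x - 2 * h \<in> maya lam" if x: "x \<in> maya lam" for x
  proof (rule ccontr)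
    assume "x - 2 * h \<notin> maya lam"
    then have "(x, x - 2 * h) \<in> inversions (maya lam)" using x assms by (simp add: inversions_def)
    then have "(x, x - 2 * h) \<in> (\<lambda>(i, j). (bead lam i, hole lam j)) ` boxes lam"
      by (simp only: bij_betw_imp_surj_on[OF bij_betw_boxes_inversions[OF lam]])
    then obtain i j where ij: "(i, j) \<in> boxes lam" "x = bead lam i" "x - 2 * h = hole lam j"
      by auto
    then have "hook lam (i, j) = int g"
      unfolding hook_eq_gap assms(2) by (simp add: gap_def)
    then show False using core ij(1) by (auto simp: is_core_def)
  qed
qed (use assms DD_zero_notin_maya bdd_above_maya in \<open>simp_all add: DD_core_def DD_def\<close>)

section \<open>The size of a doubled distinct partition\<close>

lemma psize_eq_sum_part: "psize lam = (\<Sum>i=1..length lam. part lam i)"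
proof -
  have "(\<Sum>i=1..length lam. part lam i) = (\<Sum>i<length lam. lam ! i)"
    by (rule sum.reindex_bij_witness[of _ Suc "\<lambda>i. i - 1"]) (auto simp: part_def)
  then show ?thesis by (simp add: psize_def sum_list_sum_nth atLeast0LessThan)
qed

lemma finite_boxes: "finite (boxes lam)"
  and card_boxes: "card (boxes lam) = psize lam"
proof -
  have "i \<le> length lam" if "1 \<le> j" "j \<le> part lam i" for i j
    using part_beyond[of lam i] that by (cases "i \<le> length lam") auto
  then have eq: "boxes lam = (SIGMA i:{1..length lam}. {1..part lam i})"
    by (auto simp: boxes_def)
  then show "finite (boxes lam)" by simp
  show "card (boxes lam) = psize lam" by (simp add: eq psize_eq_sum_part)
qed

text \<open>The size is a sum of \<open>bead lam i + i\<close>. The negative beads are the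
  \<open>- y\<close> for the positive \<open>y\<close> that are not beads; cancelling these against
  the indices leaves each positive bead twice.\<close>

lemma DD_psize:
  assumes "DD lam"
  shows "int (psize lam) = 2 * (\<Sum>x\<in>{x \<in> maya lam. 0 < x}. x)"
proof -
  have lam: "is_partition lam" using assms by (simp add: DD_def)
  \<comment> \<open>Large enough that no bead exceeds \<open>L\<close> and that the first
    \<open>L\<close> beads are precisely those at least \<open>- L\<close>.\<close>
  define L where "L = length lam + part lam 1"
  let ?X = "{x \<in> maya lam. 0 < x}" and ?W = "{x \<in> maya lam. - int L \<le> x}"
  have le: "x \<le> int L" if "x \<in> maya lam" for x
    using that bead_le_iff[OF lam, of 1] by (force simp: maya_def L_def bead_def)
  then have sub: "?X \<subseteq> {1..int L}" by auto
  have "psize lam = (\<Sum>i=1..L. part lam i)"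
    unfolding psize_eq_sum_part by (rule sum.mono_neutral_left) (auto simp: L_def part_beyond)
  then have "int (psize lam) = (\<Sum>i=1..L. bead lam i + int i)" by (simp add: bead_def)
  then have size: "int (psize lam) = (\<Sum>i=1..L. bead lam i) + (\<Sum>i=1..L. int i)"
    by (simp add: sum.distrib)
  have "bij_betw (bead lam) {1..L} ?W"
  proof (rule bij_betw_imageI)
    show "inj_on (bead lam) {1..L}"
    proof (rule inj_onI)
      fix i k assume "i \<in> {1..L}" "k \<in> {1..L}" "bead lam i = bead lam k"
      then show "i = k" using bead_le_iff[OF lam, of i k] bead_le_iff[OF lam, of k i] by simp
    qed
    have *: "- int L \<le> bead lam i \<longleftrightarrow> i \<le> L" for i
      using part_beyond[of lam i] by (cases "i \<le> length lam") (auto simp: bead_def L_def)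
    show "bead lam ` {1..L} = ?W"
    proof (intro equalityI subsetI)
      fix x assume "x \<in> bead lam ` {1..L}"
      then obtain i where "i \<in> {1..L}" "x = bead lam i" by blast
      then show "x \<in> ?W" by (simp add: maya_def *)
    next
      fix x assume "x \<in> ?W"
      then obtain i where "1 \<le> i" "x = bead lam i" "i \<le> L" by (auto simp: maya_def *)
      then show "x \<in> bead lam ` {1..L}" by simp
    qed
  qed
  then have beads: "(\<Sum>i=1..L. bead lam i) = (\<Sum>x\<in>?W. x)"
    by (rule sum.reindex_bij_betw[where g = "\<lambda>x. x"])
  have W: "?W = ?X \<union> uminus ` ({1..int L} - ?X)"
  proof (intro equalityI subsetI)
    fix x assume x: "x \<in> ?W"
    then have "x \<noteq> 0" using DD_zero_notin_maya[OF assms] by auto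
    then consider "0 < x" | "0 < - x" by linarith
    then show "x \<in> ?X \<union> uminus ` ({1..int L} - ?X)"
    proof cases
      case 2
      then have "- x \<in> {1..int L} - ?X" using x DD_pos_reflect[OF assms, of "- x"] by auto
      then have "- (- x) \<in> uminus ` ({1..int L} - ?X)" by (rule imageI)
      then show ?thesis by simp
    qed (use x in simp)
  next
    fix x assume "x \<in> ?X \<union> uminus ` ({1..int L} - ?X)"
    then show "x \<in> ?W" using DD_pos_reflect[OF assms] by auto
  qed
  have "(\<Sum>x\<in>?W. x) = (\<Sum>x\<in>?X. x) + (\<Sum>x\<in>uminus ` ({1..int L} - ?X). x)"
    unfolding W using finite_subset[OF sub] by (intro sum.union_disjoint) auto
  moreover have "(\<Sum>x\<in>uminus ` ({1..int L} - ?X). x) = - (\<Sum>x\<in>{1..int L} - ?X. x)"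
    by (subst sum.reindex) (auto simp: sum_negf)
  moreover have "(\<Sum>x\<in>{1..int L} - ?X. x) = (\<Sum>x\<in>{1..int L}. x) - (\<Sum>x\<in>?X. x)"
    by (rule sum_diff) (use sub in auto)
  moreover have "(\<Sum>x\<in>{1..int L}. x) = (\<Sum>i=1..L. int i)"
    by (rule sum.reindex_bij_witness[of _ int nat]) auto
  ultimately show ?thesis using size beads by simp
qed

section \<open>The coding vector\<close>

context doubled_maya begin

lemma core_iterate: "x \<in> S \<Longrightarrow> x - int k * (2 * h) \<in> S"
proof (induction k)
  case (Suc k)
  then show ?case using core[of "x - int k * (2 * h)"] by (simp add: algebra_simps)
qed simp

text \<open>A higher bead on the same runner would lie at or above \<open>b\<close>, and
  \<open>core\<close> would carry it down to \<open>b\<close>.\<close>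

lemma le_first_gap:
  assumes "b \<in> first_gaps" "x \<in> S" "x mod (2 * h) = b mod (2 * h)"
  shows "x \<le> b - 2 * h"
proof (rule ccontr)
  assume "\<not> x \<le> b - 2 * h"
  obtain k where k: "x - b = 2 * h * k"
    using assms(3) by (metis mod_eq_dvd_iff dvdE)
  then have "2 * h * (- 1) < 2 * h * k" using \<open>\<not> x \<le> b - 2 * h\<close> by simp
  then have "- 1 < k" by (rule mult_left_less_imp_less) (use h_pos in simp)
  then have "b = x - int (nat k) * (2 * h)" using k by (simp add: algebra_simps)
  then have "b \<in> S" using core_iterate[OF assms(2), of "nat k"] by (simp only:)
  then show False using assms(1) by (simp add: first_gaps_def)
qed

text \<open>Each runner is occupied far below and empty far above; the gap follows its topmost
  bead.\<close>

lemma first_gap_exists: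
  assumes "0 \<le> r" "r < 2 * h"
  obtains b where "b \<in> first_gaps" "b mod (2 * h) = r"
proof -
  obtain N where N: "0 < N" "\<And>x. x \<in> S \<Longrightarrow> x < N" "\<And>x. x \<notin> S \<Longrightarrow> - N < x" by (rule bounds) blast
  define x where "x = r - 2 * h * (N + 1)"
  let ?A = "{y \<in> S. x \<le> y \<and> y mod (2 * h) = r}"
  have "1 * N \<le> 2 * h * N" using h_pos N(1) by (intro mult_right_mono) auto
  then have "x < - N" using assms by (simp add: x_def algebra_simps)
  then have "x \<in> S" using N(3)[of x] by linarith
  moreover have "x mod (2 * h) = r"
  proof -
    have "x = r + 2 * h * (- (N + 1))" by (simp add: x_def algebra_simps)
    then have "x mod (2 * h) = r mod (2 * h)" by (simp only: mod_mult_self2)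
    then show ?thesis using assms by simp
  qed
  ultimately have ne: "?A \<noteq> {}" by auto
  have "y \<le> N" if "y \<in> S" for y using N(2)[OF that] by simp
  then have "?A \<subseteq> {x..N}" by auto
  then have fin: "finite ?A" by (rule finite_subset) simp
  define b where "b = Max ?A + 2 * h"
  have Max: "Max ?A \<in> S" "x \<le> Max ?A" "Max ?A mod (2 * h) = r" using Max_in[OF fin ne] by auto
  have mod: "b mod (2 * h) = r" using Max by (simp add: b_def)
  have "b \<notin> S"
  proof
    assume "b \<in> S"
    then have "b \<in> ?A" using Max mod h_pos by (simp add: b_def)
    then have "b \<le> Max ?A" by (rule Max_ge[OF fin])
    then show False using h_pos by (simp add: b_def)
  qed
  then have "b \<in> first_gaps" using Max by (simp add: first_gaps_def b_def)
  then show thesis using that mod by blast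
qed

end

text \<open>The greatest bead on the runner of \<open>b\<close> is \<open>b - 2 * h\<close>, and
  \<open>beta\<close> adds \<open>g\<close>.\<close>

lemma beta_eq_first_gap:
  assumes "doubled_maya (maya lam) h" "int g = 2 * h" "b \<in> doubled_maya.first_gaps (maya lam) h"
  shows "beta lam g (nat (b mod (2 * h))) = b"
proof -
  interpret doubled_maya "maya lam" h by fact
  have r: "int (nat (b mod (2 * h))) = b mod (2 * h)" using h_pos by simp
  have eq: "{int (part lam j) - int j | j. 1 \<le> j \<and> (int (part lam j) - int j) mod int g = b mod (2 * h)}
      = {x \<in> maya lam. x mod (2 * h) = b mod (2 * h)}"
    by (auto simp: maya_def bead_def assms(2))
  have "(GREATEST x. x \<in> {x \<in> maya lam. x mod (2 * h) = b mod (2 * h)}) = b - 2 * h"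
    by (rule Greatest_equality) (use assms(3) le_first_gap in \<open>auto simp: first_gaps_def\<close>)
  then show ?thesis unfolding beta_def r eq using assms(2) by simp
qed

lemma bij_betw_beta:
  assumes "doubled_maya (maya lam) h" "int g = 2 * h"
  shows "bij_betw (beta lam g) {0..<g} (doubled_maya.first_gaps (maya lam) h)"
proof -
  interpret doubled_maya "maya lam" h by fact
  have *: "beta lam g r \<in> first_gaps \<and> nat (beta lam g r mod (2 * h)) = r" if r: "r < g" for r
  proof -
    obtain b where "b \<in> first_gaps" "b mod (2 * h) = int r"
      using first_gap_exists[of "int r"] r assms(2) by auto
    then show ?thesis using beta_eq_first_gap[OF assms, of b] by auto
  qed
  show ?thesis
  proof (rule bij_betw_byWitness[where f' = "\<lambda>b. nat (b mod (2 * h))"])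
    show "(\<lambda>b. nat (b mod (2 * h))) ` first_gaps \<subseteq> {0..<g}"
    proof (intro image_subsetI)
      fix b
      have "b mod (2 * h) < int g" "0 \<le> b mod (2 * h)" using h_pos assms(2) by simp_all
      then show "nat (b mod (2 * h)) \<in> {0..<g}" by (simp add: nat_less_iff)
    qed
  qed (use * beta_eq_first_gap[OF assms] in auto)
qed

lemma sorted_list_of_set_Un:
  fixes A B :: "'a :: linorder set"
  assumes "finite A" "finite B" "\<And>a b. a \<in> A \<Longrightarrow> b \<in> B \<Longrightarrow> a < b"
  shows "sorted_list_of_set (A \<union> B) = sorted_list_of_set A @ sorted_list_of_set B"
proof (rule sorted_distinct_set_unique)
  show "sorted (sorted_list_of_set A @ sorted_list_of_set B)"
    using assms by (auto simp: sorted_append less_imp_le)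
  show "distinct (sorted_list_of_set A @ sorted_list_of_set B)"
    using assms by auto
qed (use assms in auto)

text \<open>Of the \<open>2 * t + 2\<close> first gaps exactly \<open>t\<close> exceed
  \<open>h\<close>, so the \<open>t\<close> largest are the shifts by \<open>h\<close> of
  \<open>pos_gaps\<close>.\<close>

lemma vcoding_eq:
  assumes "doubled_maya (maya lam) h" "int g = 2 * h" "h = int t + 1"
  shows "vcoding lam g t
      = rev (sorted_list_of_set ((\<lambda>p. p + h) ` doubled_maya.pos_gaps (maya lam) h))"
    and "card (doubled_maya.pos_gaps (maya lam) h) = t"
proof -
  interpret doubled_maya "maya lam" h by fact
  have bij: "bij_betw (beta lam g) {0..<g} first_gaps" by (rule bij_betw_beta[OF assms(1,2)])
  have "card first_gaps = g" using bij_betw_same_card[OF bij] by simp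
  then show card: "card pos_gaps = t" using card_first_gaps assms(2,3) by simp
  let ?Hi = "(\<lambda>p. p + h) ` pos_gaps" and ?Lo = "{b \<in> first_gaps. b \<le> h}"
  have Hi: "?Hi = {b \<in> first_gaps. h < b}"
  proof (intro equalityI subsetI)
    fix b assume "b \<in> {b \<in> first_gaps. h < b}"
    then have "b - h \<in> pos_gaps" by (simp add: pos_gaps_def)
    then have "b - h + h \<in> ?Hi" by (rule imageI)
    then show "b \<in> ?Hi" by simp
  qed (auto simp: pos_gaps_def)
  have "beta lam g ` {0..<g} = ?Lo \<union> ?Hi"
    unfolding Hi bij_betw_imp_surj_on[OF bij] by auto
  then have "sorted_list_of_set (beta lam g ` {0..<g})
      = sorted_list_of_set ?Lo @ sorted_list_of_set ?Hi"
    using finite_first_gaps by (simp only:, intro sorted_list_of_set_Un) (auto simp: Hi)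
  moreover have "length (sorted_list_of_set ?Hi) = t"
    using card by (simp add: card_image inj_on_def)
  ultimately show "vcoding lam g t = rev (sorted_list_of_set ?Hi)"
    by (simp add: vcoding_def)
qed

lemma sorted_enumeration:
  fixes A :: "int set"
  assumes "finite A" "\<And>i. r i = rev (sorted_list_of_set ((\<lambda>p. p + c) ` A)) ! (i - 1) - c"
  shows "bij_betw r {1..card A} A"
    and "\<And>i j. 1 \<le> i \<Longrightarrow> i < j \<Longrightarrow> j \<le> card A \<Longrightarrow> r j < r i"
proof -
  let ?xs = "rev (sorted_list_of_set ((\<lambda>p. p + c) ` A))"
  have len: "length ?xs = card A" by (simp add: card_image inj_on_def)
  have "sorted_wrt (<) (sorted_list_of_set ((\<lambda>p. p + c) ` A))" by simp
  then have dec: "sorted_wrt (>) ?xs" by (simp add: sorted_wrt_rev)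
  show "r j < r i" if "1 \<le> i" "i < j" "j \<le> card A" for i j
    using sorted_wrt_nth_less[OF dec, of "i - 1" "j - 1"] that len by (simp add: assms(2))
  have "bij_betw (\<lambda>i. i - 1) {1..card A} {..<length ?xs}"
    unfolding len by (rule bij_betw_byWitness[where f' = Suc]) auto
  moreover have "bij_betw ((!) ?xs) {..<length ?xs} ((\<lambda>p. p + c) ` A)"
    by (rule bij_betw_nth) (use assms(1) in simp_all)
  moreover have "bij_betw (\<lambda>x. x - c) ((\<lambda>p. p + c) ` A) A"
    by (rule bij_betw_byWitness[where f' = "\<lambda>p. p + c"]) auto
  ultimately have "bij_betw ((\<lambda>x. x - c) \<circ> ((!) ?xs \<circ> (\<lambda>i. i - 1))) {1..card A} A"
    by (intro bij_betw_trans)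
  moreover have "(\<lambda>x. x - c) \<circ> ((!) ?xs \<circ> (\<lambda>i. i - 1)) = r" by (simp add: fun_eq_iff assms(2))
  ultimately show "bij_betw r {1..card A} A" by simp
qed

text \<open>Since \<open>r\<close> decreases, the ordered pairs are the \<open>(r i, r j)\<close>
  with \<open>i < j\<close>.\<close>

lemma prod_root_values:
  fixes \<tau> :: "int \<Rightarrow> 'a :: comm_monoid_mult" and r :: "nat \<Rightarrow> int"
  assumes bij: "bij_betw r {1..t} P" and dec: "\<And>i j. 1 \<le> i \<Longrightarrow> i < j \<Longrightarrow> j \<le> t \<Longrightarrow> r j < r i"
  shows "(\<Prod>x\<in>#root_values P. \<tau> x)
    = (\<Prod>p\<in>P. \<tau> p) * (\<Prod>i=1..t. \<Prod>j=i+1..t. \<tau> (r i - r j) * \<tau> (r i + r j))"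
proof -
  let ?I = "SIGMA i:{1..t}. {i+1..t}"
  have inj: "inj_on r {1..t}" and im: "P = r ` {1..t}" using bij by (auto simp: bij_betw_def)
  have "bij_betw (\<lambda>(i, j). (r i, r j)) ?I (ordered_pairs P)"
  proof (rule bij_betw_imageI)
    show "inj_on (\<lambda>(i, j). (r i, r j)) ?I"
    proof (rule inj_onI)
      fix a b assume ab: "a \<in> ?I" "b \<in> ?I" "(\<lambda>(i, j). (r i, r j)) a = (\<lambda>(i, j). (r i, r j)) b"
      have "fst a \<in> {1..t}" "snd a \<in> {1..t}" "fst b \<in> {1..t}" "snd b \<in> {1..t}"
        using ab(1,2) by auto
      then show "a = b"
        using ab(3) inj_onD[OF inj, of "fst a" "fst b"] inj_onD[OF inj, of "snd a" "snd b"]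
        by (simp add: case_prod_beta prod_eq_iff)
    qed
    show "(\<lambda>(i, j). (r i, r j)) ` ?I = ordered_pairs P"
    proof (intro equalityI subsetI)
      fix x assume "x \<in> ordered_pairs P"
      then obtain i j where ij: "x = (r i, r j)" "i \<in> {1..t}" "j \<in> {1..t}" "r j < r i"
        by (auto simp: ordered_pairs_def im)
      then have "i < j" using dec[of j i] by (cases i j rule: linorder_cases) auto
      then show "x \<in> (\<lambda>(i, j). (r i, r j)) ` ?I" using ij by force
    qed (use dec in \<open>auto simp: ordered_pairs_def im\<close>)
  qed
  then have "(\<Prod>(p, q)\<in>ordered_pairs P. \<tau> (p - q) * \<tau> (p + q))
      = (\<Prod>x\<in>?I. case (\<lambda>(i, j). (r i, r j)) x of (p, q) \<Rightarrow> \<tau> (p - q) * \<tau> (p + q))"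
    by (rule prod.reindex_bij_betw[symmetric])
  also have "\<dots> = (\<Prod>i=1..t. \<Prod>j=i+1..t. \<tau> (r i - r j) * \<tau> (r i + r j))"
    by (subst prod.Sigma) (auto intro!: prod.cong)
  finally show ?thesis
    by (simp add: root_values_def prod_unfold_prod_mset image_mset.compositionality o_def
        case_prod_beta prod_mset.distrib mult.assoc)
qed

text \<open>As \<open>(p - q)^2 + (p + q)^2 = 2 * (p^2 + q^2)\<close> and each element lies in
  \<open>card P - 1\<close> pairs, its square is counted \<open>1 + 2 * (card P - 1)\<close>
  times.\<close>

lemma sum_root_values_squares:
  assumes "finite P"
  shows "(\<Sum>x\<in>#root_values P. x\<^sup>2) = (2 * int (card P) - 1) * (\<Sum>p\<in>P. p\<^sup>2)"
proof -
  let ?O = "ordered_pairs P" and ?s = "\<lambda>x :: int \<times> int. (fst x)\<^sup>2 + (snd x)\<^sup>2"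
  have fin: "finite ?O" by (rule finite_ordered_pairs[OF assms])
  \<comment> \<open>The summand is symmetric, so its sum over pairs follows from the full square
    without the diagonal.\<close>
  have "P \<times> P = (?O \<union> prod.swap ` ?O) \<union> (\<lambda>p. (p, p)) ` P"
    by (auto simp: ordered_pairs_def image_iff)
  then have "sum ?s (P \<times> P) = sum ?s ((?O \<union> prod.swap ` ?O) \<union> (\<lambda>p. (p, p)) ` P)" by simp
  also have "\<dots> = sum ?s (?O \<union> prod.swap ` ?O) + sum ?s ((\<lambda>p. (p, p)) ` P)"
    using fin assms by (intro sum.union_disjoint) (auto simp: ordered_pairs_def)
  finally have "sum ?s (P \<times> P) = sum ?s (?O \<union> prod.swap ` ?O) + sum ?s ((\<lambda>p. (p, p)) ` P)" .
  moreover have "sum ?s (?O \<union> prod.swap ` ?O) = sum ?s ?O + sum ?s (prod.swap ` ?O)"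
    using fin by (intro sum.union_disjoint) (auto simp: ordered_pairs_def)
  moreover have "sum ?s (prod.swap ` ?O) = sum ?s ?O"
    by (subst sum.reindex) (auto simp: add.commute)
  moreover have "sum ?s ((\<lambda>p. (p, p)) ` P) = 2 * (\<Sum>p\<in>P. p\<^sup>2)"
    by (subst sum.reindex) (auto simp: inj_on_def sum_distrib_left)
  moreover have "sum ?s (P \<times> P) = 2 * int (card P) * (\<Sum>p\<in>P. p\<^sup>2)"
  proof -
    have "sum ?s (P \<times> P) = (\<Sum>p\<in>P. \<Sum>q\<in>P. p\<^sup>2 + q\<^sup>2)"
      by (simp add: sum.cartesian_product case_prod_beta)
    also have "\<dots> = 2 * int (card P) * (\<Sum>p\<in>P. p\<^sup>2)"
      by (simp add: sum.distrib sum_distrib_left mult.assoc)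
    finally show ?thesis .
  qed
  ultimately have "2 * sum ?s ?O = (2 * int (card P) - 2) * (\<Sum>p\<in>P. p\<^sup>2)"
    by (simp add: algebra_simps)
  moreover have "(\<Sum>x\<in>#root_values P. x\<^sup>2) = (\<Sum>p\<in>P. p\<^sup>2) + (\<Sum>x\<in>?O. (fst x - snd x)\<^sup>2 + (fst x + snd x)\<^sup>2)"
    by (simp add: root_values_def sum_unfold_sum_mset image_mset.compositionality o_def
        case_prod_beta sum_mset.distrib)
  moreover have "(\<Sum>x\<in>?O. (fst x - snd x)\<^sup>2 + (fst x + snd x)\<^sup>2) = 2 * sum ?s ?O"
    unfolding sum_distrib_left
    by (rule sum.cong) (auto simp: power2_eq_square algebra_simps)
  ultimately show ?thesis by (simp add: algebra_simps)
qed

section \<open>Sums and products over the multiset identity\<close>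

context doubled_maya begin

text \<open>By \<open>side_gaps\<close>, each positive \<open>x\<close> contributes to side
  \<open>1\<close> an extra gap \<open>2 * x\<close> and an extra gap \<open>x\<close>.\<close>

lemma sum_side_gap:
  "(\<Sum>p\<in>inversions S. side p * gap p) = 3 * (\<Sum>x\<in>{x \<in> S. 0 < x}. x)"
proof -
  let ?H = "\<lambda>s. {p \<in> inversions S. side p = s}"
  have "inversions S = ?H 1 \<union> ?H (- 1)" by (auto simp: side_def)
  then have "(\<Sum>p\<in>inversions S. side p * gap p) = (\<Sum>p\<in>?H 1 \<union> ?H (- 1). side p * gap p)" by simp
  also have "\<dots> = (\<Sum>p\<in>?H 1. side p * gap p) + (\<Sum>p\<in>?H (- 1). side p * gap p)"
    using finite_inversions by (intro sum.union_disjoint) auto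
  also have "(\<Sum>p\<in>?H 1. side p * gap p) = (\<Sum>p\<in>?H 1. gap p)" by (rule sum.cong) auto
  also have "(\<Sum>p\<in>?H (- 1). side p * gap p) = - (\<Sum>p\<in>?H (- 1). gap p)"
    unfolding sum_negf[symmetric] by (rule sum.cong) auto
  also have "(\<Sum>p\<in>?H 1. gap p) = (\<Sum>p\<in>?H (- 1). gap p) + 3 * (\<Sum>x\<in>{x \<in> S. 0 < x}. x)"
    using arg_cong[OF side_gaps, of sum_mset]
    by (simp add: sum_unfold_sum_mset sum_mset_distrib_left[symmetric])
  finally show ?thesis by simp
qed

text \<open>Summing squares over the multiset identity makes the linear term \<open>side p * gap p\<close> appear.\<close>

lemma card_inversions_squares:
  "4 * h\<^sup>2 * int (card (inversions S)) - 12 * h * (\<Sum>x\<in>{x \<in> S. 0 < x}. x)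
    + (\<Sum>x\<in>#root_values {1..<h}. x\<^sup>2) = (\<Sum>x\<in>#root_values pos_gaps. x\<^sup>2)"
proof -
  have "(\<Sum>p\<in>inversions S. \<bar>gap p - side p * (2 * h)\<bar>\<^sup>2) + (\<Sum>x\<in>#root_values {1..<h}. x\<^sup>2)
      = (\<Sum>p\<in>inversions S. (gap p)\<^sup>2) + (\<Sum>x\<in>#root_values pos_gaps. x\<^sup>2)"
    using arg_cong[OF reflected_gaps, of "\<lambda>M. \<Sum>x\<in>#M. x\<^sup>2"]
    by (simp add: sum_unfold_sum_mset image_mset.compositionality o_def)
  \<comment> \<open>The last term is constant because \<open>side p\<close> squares to
    \<open>1\<close>.\<close>
  moreover have "(\<Sum>p\<in>inversions S. \<bar>gap p - side p * (2 * h)\<bar>\<^sup>2)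
      = (\<Sum>p\<in>inversions S. (gap p)\<^sup>2 - 4 * h * (side p * gap p) + 4 * h\<^sup>2)"
    by (rule sum.cong) (auto simp: side_def power2_eq_square algebra_simps)
  moreover have "\<dots> = (\<Sum>p\<in>inversions S. (gap p)\<^sup>2) - 4 * h * (\<Sum>p\<in>inversions S. side p * gap p)
      + 4 * h\<^sup>2 * int (card (inversions S))"
    by (simp add: sum.distrib sum_subtractf sum_distrib_left)
  ultimately show ?thesis unfolding sum_side_gap by simp
qed

end

section \<open>The size formula and the product formula\<close>

lemma sum_squares_staircase: "6 * (\<Sum>x\<in>{1..<int t + 1}. x\<^sup>2) = int t * (int t + 1) * (2 * int t + 1)"
proof (induction t)
  case (Suc t)
  have "{1..<int (Suc t) + 1} = insert (int t + 1) {1..<int t + 1}" by auto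
  then have "(\<Sum>x\<in>{1..<int (Suc t) + 1}. x\<^sup>2) = (int t + 1)\<^sup>2 + (\<Sum>x\<in>{1..<int t + 1}. x\<^sup>2)" by simp
  then show ?case using Suc.IH by (simp add: power2_eq_square algebra_simps)
qed simp

text \<open>The shifted argument is negative only if \<open>e u = 1\<close> and
  \<open>f u < g\<close>. Passing to its absolute value \<open>i = g - f u\<close> then costs the
  factor \<open>\<tau> (- i) / \<tau> i\<close>, and grouping by \<open>i\<close> produces the
  powers.\<close>

lemma prod_shifted_ratio:
  fixes \<tau> :: "int \<Rightarrow> 'a :: field" and f e :: "'b \<Rightarrow> int"
  assumes fin: "finite U" and nz: "\<And>x. \<tau> x \<noteq> 0"
    and pos: "\<And>u. u \<in> U \<Longrightarrow> 0 < f u" and ne: "\<And>u. u \<in> U \<Longrightarrow> f u \<noteq> int g"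
    and e: "\<And>u. u \<in> U \<Longrightarrow> e u = 1 \<or> e u = - 1"
  shows "(\<Prod>u\<in>U. \<tau> (f u - e u * int g) / \<tau> (f u))
    = (\<Prod>i=1..g-1. (\<tau> (- int i) / \<tau> (int i)) ^ card {u \<in> U. f u = int g - int i \<and> e u = 1})
      * ((\<Prod>u\<in>U. \<tau> \<bar>f u - e u * int g\<bar>) / (\<Prod>u\<in>U. \<tau> (f u)))"
proof -
  define V where "V = {u \<in> U. e u = 1 \<and> f u < int g}"
  define c where "c u = \<tau> (- int (nat (int g - f u))) / \<tau> (int (nat (int g - f u)))" for u
  have "\<tau> (f u - e u * int g) / \<tau> (f u)
      = (if u \<in> V then c u else 1) * (\<tau> \<bar>f u - e u * int g\<bar> / \<tau> (f u))" if u: "u \<in> U" for u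
  proof (cases "u \<in> V")
    case True
    then have "int (nat (int g - f u)) = int g - f u" "e u = 1" by (auto simp: V_def)
    then show ?thesis using True nz by (simp add: c_def V_def)
  next
    case False
    then have "0 \<le> f u - e u * int g" using e[OF u] pos[OF u] u by (auto simp: V_def)
    then show ?thesis using False by simp
  qed
  then have "(\<Prod>u\<in>U. \<tau> (f u - e u * int g) / \<tau> (f u))
      = (\<Prod>u\<in>U. (if u \<in> V then c u else 1) * (\<tau> \<bar>f u - e u * int g\<bar> / \<tau> (f u)))"
    by (rule prod.cong[OF refl])
  also have "\<dots> = (\<Prod>u\<in>U. if u \<in> V then c u else 1) * ((\<Prod>u\<in>U. \<tau> \<bar>f u - e u * int g\<bar>) / (\<Prod>u\<in>U. \<tau> (f u)))"
    by (simp only: prod.distrib prod_dividef)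
  also have "(\<Prod>u\<in>U. if u \<in> V then c u else 1) = (\<Prod>u\<in>V. c u)"
    using fin by (subst prod.inter_restrict[symmetric]) (auto simp: V_def Int_def intro: prod.cong)
  also have "(\<Prod>u\<in>V. c u) = (\<Prod>i=1..g-1. \<Prod>u\<in>{u \<in> V. nat (int g - f u) = i}. c u)"
  proof (rule prod.group[symmetric])
    show "(\<lambda>u. nat (int g - f u)) ` V \<subseteq> {1..g-1}"
    proof (intro image_subsetI)
      fix u assume "u \<in> V"
      then have "0 < f u" "f u < int g" using pos by (auto simp: V_def)
      then show "nat (int g - f u) \<in> {1..g-1}" by auto
    qed
  qed (use fin in \<open>auto simp: V_def\<close>)
  also have "\<dots> = (\<Prod>i=1..g-1. (\<tau> (- int i) / \<tau> (int i)) ^ card {u \<in> U. f u = int g - int i \<and> e u = 1})"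
  proof (rule prod.cong[OF refl])
    fix i assume i: "i \<in> {1..g-1}"
    have "{u \<in> V. nat (int g - f u) = i} = {u \<in> U. f u = int g - int i \<and> e u = 1}"
      using i by (auto simp: V_def)
    moreover have "(\<Prod>u\<in>{u \<in> V. nat (int g - f u) = i}. c u)
        = (\<Prod>u\<in>{u \<in> V. nat (int g - f u) = i}. \<tau> (- int i) / \<tau> (int i))"
      by (rule prod.cong) (auto simp: c_def)
    ultimately show "(\<Prod>u\<in>{u \<in> V. nat (int g - f u) = i}. c u)
        = (\<tau> (- int i) / \<tau> (int i)) ^ card {u \<in> U. f u = int g - int i \<and> e u = 1}"
      by (simp only: prod_constant)
  qed
  finally show ?thesis .
qed

theorem theorem3p2:
  fixes t g :: nat and \<omega> :: "nat list" and v r :: "nat \<Rightarrow> int"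
    and \<tau> :: "int \<Rightarrow> 'a :: field"
  assumes "t \<ge> 1" and "g = 2 * t + 2"
    and "DD_core g \<omega>"
    and "\<And>i. v i = vcoding \<omega> g t ! (i - 1)"
    and "\<And>i. r i = v i - int t - 1"
    and "\<And>x. \<tau> x \<noteq> 0"
  shows "((of_nat (psize \<omega>) :: rat) =
           (\<Sum>i=1..t. (of_int (r i))^2) / of_nat g
           - (of_nat g / 2 - 1) * (of_nat g - 1) / 12) \<and>
         ((\<Prod>s\<in>boxes \<omega>. \<tau> (hook \<omega> s - eps s * int g) / \<tau> (hook \<omega> s)) =
           (\<Prod>i=1..g-1. (\<tau> (- int i) / \<tau> (int i)) ^
               card {u \<in> boxes \<omega>. hook \<omega> u = int g - int i \<and> eps u = 1})
         * (\<Prod>i=1..t. \<tau> (r i) / \<tau> (int i))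
         * (\<Prod>i=1..t. \<Prod>j=i+1..t.
              (\<tau> (r i - r j) / \<tau> (int j - int i)) * (\<tau> (r i + r j) / \<tau> (int g - int i - int j))))"
proof
  define h where "h = int t + 1"
  have g: "int g = 2 * h" using assms(2) by (simp add: h_def)
  have DD: "DD \<omega>" using assms(3) by (simp add: DD_core_def)
  then have part: "is_partition \<omega>" by (simp add: DD_def)
  have maya: "doubled_maya (maya \<omega>) h"
    by (rule doubled_maya_DD_core[OF assms(3) g]) (simp add: h_def)
  then interpret doubled_maya "maya \<omega>" h .
  have card_P: "card pos_gaps = t" by (rule vcoding_eq(2)[OF maya g h_def])
  \<comment> \<open>As \<open>h = t + 1\<close>, passing from \<open>v i\<close> to
    \<open>r i\<close> undoes the shift by \<open>h\<close>.\<close>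
  have r: "r i = rev (sorted_list_of_set ((\<lambda>p. p + h) ` pos_gaps)) ! (i - 1) - h" for i
    by (simp only: assms(4,5) vcoding_eq(1)[OF maya g h_def]) (simp add: h_def)
  have bij_r: "bij_betw r {1..t} pos_gaps"
    using sorted_enumeration(1)[OF finite_pos_gaps r] by (simp only: card_P)
  have dec_r: "r j < r i" if "1 \<le> i" "i < j" "j \<le> t" for i j
    using sorted_enumeration(2)[OF finite_pos_gaps r that(1,2)] that(3) by (simp only: card_P)
  let ?b = "\<lambda>(i, j). (bead \<omega> i, hole \<omega> j)"
  note bij = bij_betw_boxes_inversions[OF part]
  have hook: "hook \<omega> s = gap (?b s)" for s
    using hook_eq_gap[of \<omega> "fst s" "snd s"] by (simp add: case_prod_beta)
  have eps: "eps s = side (?b s)" if "s \<in> boxes \<omega>" for s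
    using eps_eq_side[OF DD, of "fst s" "snd s"] that by (simp add: case_prod_beta)
  have inv: "?b s \<in> inversions (maya \<omega>)" if "s \<in> boxes \<omega>" for s
    using bij_betw_apply[OF bij that] .

  show "(of_nat (psize \<omega>) :: rat) = (\<Sum>i=1..t. (of_int (r i))^2) / of_nat g
      - (of_nat g / 2 - 1) * (of_nat g - 1) / 12"
  proof -
    let ?n = "int (psize \<omega>)" and ?R = "\<Sum>p\<in>pos_gaps. p\<^sup>2" and ?B = "\<Sum>p\<in>{1..<h}. p\<^sup>2"
    have "card (inversions (maya \<omega>)) = psize \<omega>"
      using bij_betw_same_card[OF bij] card_boxes[of \<omega>] by simp
    moreover have "card {1..<h} = t" by (simp add: h_def)
    \<comment> \<open>The size is twice the sum of the positive beads, which turns the coefficient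
      \<open>12 * h\<close> into \<open>6 * h\<close>.\<close>
    ultimately have "4 * h\<^sup>2 * ?n - 6 * h * ?n + (2 * int t - 1) * ?B = (2 * int t - 1) * ?R"
      using card_inversions_squares DD_psize[OF DD] sum_root_values_squares[OF finite_pos_gaps]
        sum_root_values_squares[of "{1..<h}"] card_P by simp
    \<comment> \<open>Since \<open>2 * h - 3 = 2 * t - 1\<close>, the factor from
      \<open>sum_root_values_squares\<close> appears here too and cancels.\<close>
    moreover have "4 * h\<^sup>2 * ?n - 6 * h * ?n = (2 * int t - 1) * (2 * h * ?n)"
      by (simp add: h_def power2_eq_square algebra_simps)
    ultimately have "(2 * int t - 1) * (2 * h * ?n + ?B) = (2 * int t - 1) * ?R"
      by (simp only: distrib_left)
    moreover have "2 * int t - 1 \<noteq> 0" using assms(1) by simp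
    ultimately have "2 * h * ?n + ?B = ?R" by (simp only: mult_cancel_left) simp
    moreover have "?R = (\<Sum>i=1..t. (r i)\<^sup>2)" by (rule sum.reindex_bij_betw[OF bij_r, symmetric])
    moreover have "6 * ?B = int t * h * (2 * int t + 1)"
      using sum_squares_staircase[of t] by (simp add: h_def)
    ultimately have "6 * (2 * h * ?n) + int t * h * (2 * int t + 1) = 6 * (\<Sum>i=1..t. (r i)\<^sup>2)"
      by linarith
    then have "(of_int (6 * (2 * h * ?n) + int t * h * (2 * int t + 1)) :: rat)
        = of_int (6 * (\<Sum>i=1..t. (r i)\<^sup>2))" by (rule arg_cong)
    then show ?thesis by (simp add: assms(2) h_def field_simps)
  qed

  show "(\<Prod>s\<in>boxes \<omega>. \<tau> (hook \<omega> s - eps s * int g) / \<tau> (hook \<omega> s)) =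
           (\<Prod>i=1..g-1. (\<tau> (- int i) / \<tau> (int i)) ^
               card {u \<in> boxes \<omega>. hook \<omega> u = int g - int i \<and> eps u = 1})
         * (\<Prod>i=1..t. \<tau> (r i) / \<tau> (int i))
         * (\<Prod>i=1..t. \<Prod>j=i+1..t.
              (\<tau> (r i - r j) / \<tau> (int j - int i)) * (\<tau> (r i + r j) / \<tau> (int g - int i - int j)))"
    (is "?lhs = ?alpha * ?single * ?double")
  proof -
    let ?H = "inversions (maya \<omega>)"
    define K where "K = (\<Prod>p\<in>?H. \<tau> \<bar>gap p - side p * (2 * h)\<bar>)"
    define G where "G = (\<Prod>p\<in>?H. \<tau> (gap p))"
    define W where "W s = (\<Prod>i=1..t. \<Prod>j=i+1..t. \<tau> (s i - s j) * \<tau> (s i + s j))" for s :: "nat \<Rightarrow> int"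
    \<comment> \<open>The decreasing enumeration of \<open>{1..<h}\<close>;
      \<open>b i - b j = j - i\<close> and \<open>b i + b j = g - i - j\<close> yield the
      denominators.\<close>
    define b where "b i = h - int i" for i
    have bij_b: "bij_betw b {1..t} {1..<h}"
      by (rule bij_betw_byWitness[where f' = "\<lambda>x. nat (h - x)"]) (auto simp: b_def h_def)
    have nz: "G \<noteq> 0" "W s \<noteq> 0" "(\<Prod>i=1..t. \<tau> (int i)) \<noteq> 0" for s
      using assms(6) finite_inversions by (simp_all add: G_def W_def)
    have "K * (\<Prod>x\<in>#root_values {1..<h}. \<tau> x) = G * (\<Prod>x\<in>#root_values pos_gaps. \<tau> x)"
      using arg_cong[OF reflected_gaps, of "\<lambda>M. \<Prod>x\<in>#M. \<tau> x"]
      by (simp add: K_def G_def prod_unfold_prod_mset image_mset.compositionality o_def)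
    moreover have "(\<Prod>x\<in>#root_values pos_gaps. \<tau> x) = (\<Prod>i=1..t. \<tau> (r i)) * W r"
      unfolding W_def prod.reindex_bij_betw[OF bij_r]
      by (rule prod_root_values[OF bij_r]) (rule dec_r)
    moreover have "(\<Prod>x\<in>#root_values {1..<h}. \<tau> x) = (\<Prod>i=1..t. \<tau> (int i)) * W b"
    proof -
      have "(\<Prod>p\<in>{1..<h}. \<tau> p) = (\<Prod>i=1..t. \<tau> (int i))"
        by (rule prod.reindex_bij_witness[of _ int nat]) (auto simp: h_def)
      moreover have "(\<Prod>x\<in>#root_values {1..<h}. \<tau> x) = (\<Prod>p\<in>{1..<h}. \<tau> p) * W b"
        unfolding W_def by (rule prod_root_values[OF bij_b]) (simp add: b_def)
      ultimately show ?thesis by (simp only:)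
    qed
    ultimately have "K / G = ((\<Prod>i=1..t. \<tau> (r i)) * W r) / ((\<Prod>i=1..t. \<tau> (int i)) * W b)"
      using nz by (simp add: frac_eq_eq mult.commute)
    also have "\<dots> = ?single * (W r / W b)" by (simp add: prod_dividef)
    also have "W r / W b = ?double"
      unfolding W_def prod_dividef[symmetric] by (simp add: b_def g algebra_simps)
    finally have KG: "K / G = ?single * ?double" .
    have "?lhs = ?alpha * ((\<Prod>u\<in>boxes \<omega>. \<tau> \<bar>hook \<omega> u - eps u * int g\<bar>) / (\<Prod>u\<in>boxes \<omega>. \<tau> (hook \<omega> u)))"
    proof (rule prod_shifted_ratio[OF finite_boxes assms(6)])
      fix u assume u: "u \<in> boxes \<omega>"
      show "0 < hook \<omega> u" unfolding hook by (rule gap_pos[OF inv[OF u]])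
      show "hook \<omega> u \<noteq> int g" unfolding hook g by (rule gap_ne[OF inv[OF u]])
      show "eps u = 1 \<or> eps u = - 1" by (simp add: eps_def case_prod_beta)
    qed
    also have "(\<Prod>u\<in>boxes \<omega>. \<tau> (hook \<omega> u)) = G"
      unfolding hook G_def by (rule prod.reindex_bij_betw[OF bij])
    also have "(\<Prod>u\<in>boxes \<omega>. \<tau> \<bar>hook \<omega> u - eps u * int g\<bar>)
        = (\<Prod>u\<in>boxes \<omega>. \<tau> \<bar>gap (?b u) - side (?b u) * (2 * h)\<bar>)"
      by (rule prod.cong[OF refl]) (simp only: hook eps g)
    also have "\<dots> = K"
      unfolding K_def by (rule prod.reindex_bij_betw[OF bij])
    finally show ?thesis unfolding KG by (simp only: mult.assoc)
  qed
qed

end
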